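(* Let $\mathcal{H}$ be a complex Hilbert space of finite dimension $d$. Let $\rho_1,\rho_2\in\mathcal{D}(\mathcal{H})$ with $\frac12\|\rho_1-\rho_2\|_1=\varepsilon$ for some $\varepsilon\in[0,1]$. Let $\rho_1-\rho_2=\varepsilon\rho_+-\varepsilon\rho_-$, where $\rho_+,\rho_-\in\mathcal{D}(\mathcal{H})$ and $\rho_+\perp\rho_-$. Then $$|S(\rho_1)-S(\rho_2)|\le \varepsilon\log\bigl(d\,\max\{\lambda_{\max}(\rho_-),\lambda_{\max}(\rho_+)\}-1\bigr)+h(\varepsilon).$$
   Context: $\mathcal{D}(\mathcal{H})$ denotes the set of quantum states (density matrices) on $\mathcal{H}$: positive semi-definite operators of unit trace. $\|\cdot\|_1$ is the trace norm. $\log$ is the natural logarithm and $0\log 0=0$. The von Neumann entropy is $S(\rho)=-\mathrm{Tr}(\rho\log\rho)$, and $h(\varepsilon)=-\varepsilon\log\varepsilon-(1-\varepsilon)\log(1-\varepsilon)$ is the binary entropy. $\lambda_{\max}(\cdot)$ is the largest eigenvalue. $\rho_+\perp\rho_-$ means that the operators have orthogonal supports. (If $\varepsilon>0$ the states $\rho_\pm$ are uniquely determined by the Jordan-Hahn decomposition of $\rho_1-\rho_2$ into positive and negative parts; if $\varepsilon=0$ they are an arbitrary choice of states with orthogonal supports.) *)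

theory Defs
  imports Complex_Main "Jordan_Normal_Form.Spectral_Radius" "Jordan_Normal_Form.Matrix_Kernel"
begin

text \<open>
  Operators on a complex Hilbert space of dimension \<open>d\<close> are represented, in an orthonormal basis, by
  the complex matrices in \<^term>\<open>carrier_mat d d\<close>.
\<close>

definition hermitian_mat :: "nat \<Rightarrow> complex mat \<Rightarrow> bool" where
  "hermitian_mat d A \<longleftrightarrow> A \<in> carrier_mat d d \<and> mat_adjoint A = A"

definition psd_mat :: "nat \<Rightarrow> complex mat \<Rightarrow> bool" where
  "psd_mat d A \<longleftrightarrow> hermitian_mat d A \<and> (\<forall>v \<in> carrier_vec d. Re ((A *\<^sub>v v) \<bullet>c v) \<ge> 0)"

definition unitary_mat :: "nat \<Rightarrow> complex mat \<Rightarrow> bool" where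
  "unitary_mat d U \<longleftrightarrow> U \<in> carrier_mat d d \<and> mat_adjoint U * U = 1\<^sub>m d"

definition mat_trace :: "complex mat \<Rightarrow> complex" where
  "mat_trace A = (\<Sum>i < dim_row A. A $$ (i, i))"

definition density_mat :: "nat \<Rightarrow> complex mat \<Rightarrow> bool" where
  "density_mat d \<rho> \<longleftrightarrow> psd_mat d \<rho> \<and> mat_trace \<rho> = 1"

text \<open>
  \<open>unitary_conj d U x\<close> is \<open>U diag(x\<^sub>0, \<dots>, x\<^sub>d\<^sub>-\<^sub>1) U\<^sup>*\<close>.  Functional calculus sends
  \<open>A = U diag(x) U\<^sup>*\<close> to \<open>f(A) = U diag(f(x)) U\<^sup>*\<close>; for Hermitian \<open>A\<close> a decomposition exists by the
  spectral theorem, and the result does not depend on its choice, see \<open>mat_fun_unitary_conj\<close>.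
\<close>

definition unitary_conj :: "nat \<Rightarrow> complex mat \<Rightarrow> (nat \<Rightarrow> real) \<Rightarrow> complex mat" where
  "unitary_conj d U x = U * mat_diag d (\<lambda>i. complex_of_real (x i)) * mat_adjoint U"

definition mat_fun :: "nat \<Rightarrow> (real \<Rightarrow> real) \<Rightarrow> complex mat \<Rightarrow> complex mat" where
  "mat_fun d f A = (THE B. \<exists>U x. unitary_mat d U \<and> A = unitary_conj d U x \<and>
                                B = unitary_conj d U (\<lambda>i. f (x i)))"

definition trace_norm :: "nat \<Rightarrow> complex mat \<Rightarrow> real" where
  "trace_norm d A = Re (mat_trace (mat_fun d sqrt (mat_adjoint A * A)))"

text \<open>
  The value of \<^term>\<open>ln\<close> at \<open>0\<close> is immaterial: \<open>\<rho> log \<rho>\<close> has eigenvalues \<open>x * ln x\<close>, so that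
  \<open>0 log 0 = 0\<close>.
\<close>

definition von_neumann_entropy :: "nat \<Rightarrow> complex mat \<Rightarrow> real" where
  "von_neumann_entropy d \<rho> = - Re (mat_trace (\<rho> * mat_fun d ln \<rho>))"

definition binary_entropy :: "real \<Rightarrow> real" where
  "binary_entropy \<epsilon> = - \<epsilon> * ln \<epsilon> - (1 - \<epsilon>) * ln (1 - \<epsilon>)"

definition lambda_max :: "complex mat \<Rightarrow> real" where
  "lambda_max A = Max {x. complex_of_real x \<in> spectrum A}"

definition mat_support :: "nat \<Rightarrow> complex mat \<Rightarrow> complex vec set" where
  "mat_support d A = {v \<in> carrier_vec d. \<forall>w \<in> mat_kernel A. v \<bullet>c w = 0}"

definition orthogonal_supports :: "nat \<Rightarrow> complex mat \<Rightarrow> complex mat \<Rightarrow> bool" where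
  "orthogonal_supports d A B \<longleftrightarrow> (\<forall>v \<in> mat_support d A. \<forall>w \<in> mat_support d B. v \<bullet>c w = 0)"

lemma mat_adjoint_dims [simp]:
  "dim_row (mat_adjoint A) = dim_col A" "dim_col (mat_adjoint A) = dim_row A"
  by (simp_all add: mat_adjoint_def)

lemma mat_adjoint_carrier: "A \<in> carrier_mat m n \<Longrightarrow> mat_adjoint A \<in> carrier_mat n m"
  by (rule carrier_matI) simp_all

lemma unitary_conj_fun_cong:
  assumes U: "unitary_mat d U" and V: "unitary_mat d V"
    and eq: "unitary_conj d U x = unitary_conj d V y"
  shows "unitary_conj d U (\<lambda>i. f (x i)) = unitary_conj d V (\<lambda>i. f (y i))"
proof -
  define D where "D z = mat_diag d (\<lambda>i. complex_of_real (z i))" for z :: "nat \<Rightarrow> real"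
  define U' V' where "U' = mat_adjoint U" and "V' = mat_adjoint V"
  define W where "W = V' * U"
  have UV: "U \<in> carrier_mat d d" "V \<in> carrier_mat d d"
    and inv: "U' * U = 1\<^sub>m d" "V' * V = 1\<^sub>m d"
    using U V unfolding unitary_mat_def U'_def V'_def by blast+
  have UV': "U' \<in> carrier_mat d d" "V' \<in> carrier_mat d d" and cD: "D z \<in> carrier_mat d d" for z
    unfolding U'_def V'_def D_def using UV by (simp_all add: mat_adjoint_carrier)
  note c = UV UV' mult_carrier_mat[OF UV'(2) UV(1), folded W_def] cD
  have inv': "U * U' = 1\<^sub>m d" "V * V' = 1\<^sub>m d"
    using mat_mult_left_right_inverse[OF c(3,1) inv(1)] mat_mult_left_right_inverse[OF c(4,2) inv(2)]
    by auto
  note a = assoc_mult_mat[where ?n\<^sub>1.0 = d and ?n\<^sub>2.0 = d and ?n\<^sub>3.0 = d and ?n\<^sub>4.0 = d]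
    mult_carrier_mat[where nr = d and n = d and nc = d]
    left_mult_one_mat[where nr = d and nc = d] right_mult_one_mat[where nr = d and nc = d]
  have UDU: "unitary_conj d U z = U * (D z * U')" and VDV: "unitary_conj d V z = V * (D z * V')" for z
    using c by (simp_all add: unitary_conj_def D_def U'_def V'_def a)
  have "W * D x = V' * (U * (D x * U') * U)"
    using c inv by (simp add: W_def a)
  also have "\<dots> = V' * (V * (D y * V') * U)"
    using eq unfolding UDU VDV by simp
  also have "\<dots> = (V' * V) * (D y * (V' * U))"
    using c by (simp add: a)
  also have "\<dots> = D y * W"
    using c inv by (simp add: W_def a)
  finally have WD: "W * D x = D y * W" .
  have ent: "(W * D z) $$ (i, j) = W $$ (i, j) * complex_of_real (z j)"
    "(D z * W) $$ (i, j) = complex_of_real (z i) * W $$ (i, j)" if "i < d" "j < d" for i j z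
    using that c(5) by (simp_all add: D_def mat_diag_mult_left[OF c(5)] mat_diag_mult_right[OF c(5)])
  have "W * D (\<lambda>i. f (x i)) = D (\<lambda>i. f (y i)) * W"
  proof (rule eq_matI)
    fix i j assume "i < dim_row (D (\<lambda>i. f (y i)) * W)" "j < dim_col (D (\<lambda>i. f (y i)) * W)"
    then have ij: "i < d" "j < d" using c(5) carrier_matD(1)[OF c(6)] by auto
    have "W $$ (i, j) * complex_of_real (x j) = complex_of_real (y i) * W $$ (i, j)"
      using arg_cong[OF WD, of "\<lambda>M. M $$ (i, j)"] unfolding ent[OF ij] .
    then have "W $$ (i, j) = 0 \<or> x j = y i" by auto
    then show "(W * D (\<lambda>i. f (x i))) $$ (i, j) = (D (\<lambda>i. f (y i)) * W) $$ (i, j)"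
      unfolding ent[OF ij] by (elim disjE) simp_all
  qed (use c(5) carrier_matD[OF c(6)] in auto)
  then have WF: "V' * (U * D (\<lambda>i. f (x i))) = D (\<lambda>i. f (y i)) * (V' * U)"
    using c by (simp add: W_def a)
  have "U * (D (\<lambda>i. f (x i)) * U') = (V * V') * (U * (D (\<lambda>i. f (x i)) * U'))"
    using c inv' by (simp add: a(2,3))
  also have "\<dots> = V * ((V' * (U * D (\<lambda>i. f (x i)))) * U')"
    using c by (simp add: a)
  also have "\<dots> = V * (D (\<lambda>i. f (y i)) * (V' * U) * U')"
    unfolding WF ..
  also have "\<dots> = V * (D (\<lambda>i. f (y i)) * (V' * (U * U')))"
    using c by (simp add: a)
  also have "\<dots> = V * (D (\<lambda>i. f (y i)) * V')"
    using c inv' by (simp add: a(2-4))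
  finally show ?thesis unfolding UDU VDV .
qed

lemma mat_fun_unitary_conj:
  assumes "unitary_mat d U"
  shows "mat_fun d f (unitary_conj d U x) = unitary_conj d U (\<lambda>i. f (x i))"
  unfolding mat_fun_def
proof (rule the_equality)
  show "\<exists>V y. unitary_mat d V \<and> unitary_conj d U x = unitary_conj d V y \<and>
    unitary_conj d U (\<lambda>i. f (x i)) = unitary_conj d V (\<lambda>i. f (y i))"
    using assms by blast
next
  fix B
  assume "\<exists>V y. unitary_mat d V \<and> unitary_conj d U x = unitary_conj d V y \<and>
    B = unitary_conj d V (\<lambda>i. f (y i))"
  then obtain V y where V: "unitary_mat d V" "unitary_conj d U x = unitary_conj d V y"
    and B: "B = unitary_conj d V (\<lambda>i. f (y i))" by blast
  show "B = unitary_conj d U (\<lambda>i. f (x i))"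
    unfolding B by (rule unitary_conj_fun_cong[OF assms V, symmetric])
qed

end

theory Submission
  imports Defs "HOL-Real_Asymp.Real_Asymp"
begin

text \<open>
  Let \<open>\<eta>(x) = - x log x\<close>.  Since \<open>\<rho>\<^sub>1 + \<epsilon> \<rho>\<^sub>- = \<rho>\<^sub>2 + \<epsilon> \<rho>\<^sub>+\<close>, the difference \<open>S(\<rho>\<^sub>1) - S(\<rho>\<^sub>2)\<close> is the
  change of \<open>Tr \<eta>\<close> along the path \<open>\<rho>\<^sub>2 + u \<rho>\<^sub>+\<close> for \<open>u\<close> from \<open>0\<close> to \<open>\<epsilon>\<close>, followed by
  \<open>\<rho>\<^sub>1 + u \<rho>\<^sub>-\<close> for \<open>u\<close> from \<open>\<epsilon>\<close> to \<open>0\<close>, so it equals the integral of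
  \<open>Tr \<rho>\<^sub>- log (\<rho>\<^sub>1 + u \<rho>\<^sub>-) - Tr \<rho>\<^sub>+ log (\<rho>\<^sub>2 + u \<rho>\<^sub>+)\<close> over \<open>0 \<le> u \<le> \<epsilon>\<close>.  Let \<open>n\<^sub>\<plusminus>\<close> be the rank of \<open>\<rho>\<^sub>\<plusminus>\<close>, let
  \<open>P\<^sub>-\<close> be the support projection of \<open>\<rho>\<^sub>-\<close>, and let \<open>\<rho>\<^sub>- \<le> \<lambda> P\<^sub>-\<close>.
  By Jensen's inequality in an eigenbasis, the first term is at most \<open>log (\<lambda> Tr P\<^sub>- (\<rho>\<^sub>1 + u \<rho>\<^sub>-))\<close>, hence at
  most \<open>log (\<lambda> (1 - \<epsilon> + u))\<close> because the support of \<open>\<rho>\<^sub>+\<close> carries mass at least \<open>\<epsilon>\<close> of \<open>\<rho>\<^sub>1\<close>; the second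
  is at most \<open>log (n\<^sub>+ / u)\<close> because \<open>\<rho>\<^sub>2 + u \<rho>\<^sub>+ \<ge> u \<rho>\<^sub>+\<close>.  The integral of
  \<open>log (1 - \<epsilon> + u) - log u\<close> is exactly \<open>h(\<epsilon>)\<close>, and \<open>n\<^sub>+ \<lambda> \<le> (d - n\<^sub>-) \<lambda> \<le> d \<lambda> - 1\<close>.
\<close>

section \<open>Orthonormal bases and quadratic forms\<close>

lemma cscalar_prod_sum:
  fixes v w :: "complex vec"
  assumes "w \<in> carrier_vec d"
  shows "v \<bullet>c w = (\<Sum>k<d. v $ k * cnj (w $ k))"
  using assms by (simp add: scalar_prod_def atLeast0LessThan)

lemma mult_mat_vec_sum:
  assumes "A \<in> carrier_mat d d" "v \<in> carrier_vec d" "k < d"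
  shows "(A *\<^sub>v v) $ k = (\<Sum>l<d. A $$ (k, l) * v $ l)"
  using assms by (simp add: scalar_prod_def atLeast0LessThan)

lemma mult_mat_sum:
  assumes "A \<in> carrier_mat n d" "B \<in> carrier_mat d m" "k < n" "l < m"
  shows "(A * B) $$ (k, l) = (\<Sum>j<d. A $$ (k, j) * B $$ (j, l))"
  using assms by (simp add: scalar_prod_def atLeast0LessThan)

lemma mat_adjoint_index:
  fixes A :: "complex mat"
  assumes "i < dim_col A" "j < dim_row A"
  shows "mat_adjoint A $$ (i, j) = cnj (A $$ (j, i))"
  using assms by (simp add: mat_adjoint_def mat_of_rows_index)

lemma hermitian_mat_index:
  assumes "hermitian_mat d A" "i < d" "j < d"
  shows "A $$ (i, j) = cnj (A $$ (j, i))"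
proof -
  have A: "A \<in> carrier_mat d d" and eq: "mat_adjoint A = A"
    using assms(1) unfolding hermitian_mat_def by blast+
  have "i < dim_col A" "j < dim_row A" using A assms(2,3) by auto
  from mat_adjoint_index[OF this] show ?thesis unfolding eq .
qed

lemma hermitian_matI:
  assumes "A \<in> carrier_mat d d" "\<And>i j. i < d \<Longrightarrow> j < d \<Longrightarrow> A $$ (i, j) = cnj (A $$ (j, i))"
  shows "hermitian_mat d A"
proof -
  have "mat_adjoint A = A"
  proof (rule eq_matI)
    fix i j assume "i < dim_row A" "j < dim_col A"
    then have ij: "i < d" "j < d" using assms(1) by auto
    then have "mat_adjoint A $$ (i, j) = cnj (A $$ (j, i))"
      using assms(1) by (intro mat_adjoint_index) auto
    then show "mat_adjoint A $$ (i, j) = A $$ (i, j)"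
      unfolding assms(2)[OF ij] .
  qed (use assms(1) in auto)
  then show ?thesis unfolding hermitian_mat_def using assms(1) by blast
qed

section \<open>Unitary matrices as orthonormal bases\<close>

lemma unitary_mat_cols:
  assumes U: "unitary_mat d U" and "i < d" "j < d"
  shows "(\<Sum>k<d. U $$ (k, i) * cnj (U $$ (k, j))) = (if i = j then 1 else 0)"
proof -
  have Uc: "U \<in> carrier_mat d d" and "mat_adjoint U * U = 1\<^sub>m d"
    using U by (auto simp: unitary_mat_def)
  then have "(mat_adjoint U * U) $$ (j, i) = (if j = i then 1 else 0)"
    using assms by simp
  moreover have "(mat_adjoint U * U) $$ (j, i) = (\<Sum>k<d. cnj (U $$ (k, j)) * U $$ (k, i))"
    using Uc assms by (subst mult_mat_sum[OF mat_adjoint_carrier Uc])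
      (auto simp: mat_adjoint_index)
  ultimately show ?thesis by (auto simp: mult.commute split: if_splits)
qed

lemma unitary_mat_rows:
  assumes U: "unitary_mat d U" and "i < d" "j < d"
  shows "(\<Sum>k<d. U $$ (i, k) * cnj (U $$ (j, k))) = (if i = j then 1 else 0)"
proof -
  have Uc: "U \<in> carrier_mat d d" and "mat_adjoint U * U = 1\<^sub>m d"
    using U by (auto simp: unitary_mat_def)
  then have "U * mat_adjoint U = 1\<^sub>m d"
    using mat_mult_left_right_inverse mat_adjoint_carrier by blast
  then have "(U * mat_adjoint U) $$ (i, j) = (if i = j then 1 else 0)"
    using assms by simp
  moreover have "(U * mat_adjoint U) $$ (i, j) = (\<Sum>k<d. U $$ (i, k) * cnj (U $$ (j, k)))"
    using Uc assms by (subst mult_mat_sum[OF Uc mat_adjoint_carrier])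
      (auto simp: mat_adjoint_index)
  ultimately show ?thesis by simp
qed

lemma unitary_matI:
  assumes Uc: "U \<in> carrier_mat d d"
    and "\<And>i j. i < d \<Longrightarrow> j < d \<Longrightarrow>
      (\<Sum>k<d. U $$ (k, i) * cnj (U $$ (k, j))) = (if i = j then 1 else 0)"
  shows "unitary_mat d U"
proof -
  have "(mat_adjoint U * U) $$ (i, j) = 1\<^sub>m d $$ (i, j)" if "i < d" "j < d" for i j
    using that Uc assms(2)[of j i]
    by (subst mult_mat_sum[OF mat_adjoint_carrier Uc]) (auto simp: mat_adjoint_index mult.commute)
  then show ?thesis
    unfolding unitary_mat_def using Uc by (auto intro!: eq_matI)
qed

lemma unitary_mat_carrier: "unitary_mat d U \<Longrightarrow> U \<in> carrier_mat d d"
  by (simp add: unitary_mat_def)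

lemma col_unitary_carrier: "unitary_mat d U \<Longrightarrow> j < d \<Longrightarrow> col U j \<in> carrier_vec d"
  using unitary_mat_carrier by fastforce

lemma col_unitary_cscalar_prod:
  assumes "unitary_mat d U" "i < d" "j < d"
  shows "col U i \<bullet>c col U j = (if i = j then 1 else 0)"
  using assms unitary_mat_carrier[of d U] unitary_mat_cols[OF assms]
  by (subst cscalar_prod_sum[of _ d]) auto

lemma unitary_conj_carrier:
  "unitary_mat d U \<Longrightarrow> unitary_conj d U x \<in> carrier_mat d d"
  using mat_adjoint_carrier unitary_mat_carrier
  unfolding unitary_conj_def by (metis mat_diag_dim mult_carrier_mat)

lemma unitary_conj_index:
  assumes "unitary_mat d U" "k < d" "l < d"
  shows "unitary_conj d U x $$ (k, l) = (\<Sum>j<d. U $$ (k, j) * complex_of_real (x j) * cnj (U $$ (l, j)))"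
proof -
  have Uc: "U \<in> carrier_mat d d" using assms unitary_mat_carrier by auto
  have "U * mat_diag d (\<lambda>i. complex_of_real (x i)) \<in> carrier_mat d d"
    using Uc by (metis mat_diag_dim mult_carrier_mat)
  then show ?thesis unfolding unitary_conj_def using assms Uc
    by (subst mult_mat_sum[OF _ mat_adjoint_carrier[OF Uc]])
      (auto simp: mat_adjoint_index mat_diag_mult_right[OF Uc])
qed

text \<open>Everything below about \<open>unitary_conj d U x\<close> is derived from this expansion
  in its eigenbasis. It follows by writing out the entries and pulling the sum over the eigenvalue
  index outside.\<close>

lemma unitary_conj_cscalar_prod:
  assumes U: "unitary_mat d U" and v: "v \<in> carrier_vec d" and w: "w \<in> carrier_vec d"
  shows "(unitary_conj d U x *\<^sub>v v) \<bullet>c w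
    = (\<Sum>j<d. complex_of_real (x j) * ((v \<bullet>c col U j) * cnj (w \<bullet>c col U j)))"
proof -
  have Uc: "U \<in> carrier_mat d d" using assms unitary_mat_carrier by auto
  have ip: "u \<bullet>c col U j = (\<Sum>k<d. u $ k * cnj (U $$ (k, j)))" if "j < d" for u :: "complex vec" and j
    using that Uc by (subst cscalar_prod_sum[of _ d]) auto
  have "(unitary_conj d U x *\<^sub>v v) \<bullet>c w = (\<Sum>k<d. \<Sum>l<d. \<Sum>j<d.
      (U $$ (k, j) * complex_of_real (x j) * cnj (U $$ (l, j))) * v $ l * cnj (w $ k))"
    using w v U by (simp add: cscalar_prod_sum[of w d] mult_mat_vec_sum[OF unitary_conj_carrier]
       unitary_conj_index sum_distrib_right del: index_mult_mat_vec)
  also have "\<dots> = (\<Sum>k<d. \<Sum>j<d. \<Sum>l<d.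
      (U $$ (k, j) * complex_of_real (x j) * cnj (U $$ (l, j))) * v $ l * cnj (w $ k))"
    by (intro sum.cong refl sum.swap)
  also have "\<dots> = (\<Sum>j<d. \<Sum>k<d. \<Sum>l<d.
      (U $$ (k, j) * complex_of_real (x j) * cnj (U $$ (l, j))) * v $ l * cnj (w $ k))"
    by (rule sum.swap)
  also have "\<dots> = (\<Sum>j<d. complex_of_real (x j) * ((v \<bullet>c col U j) * cnj (w \<bullet>c col U j)))"
  proof (intro sum.cong refl)
    fix j assume "j \<in> {..<d}"
    then have j: "j < d" by simp
    show "(\<Sum>k<d. \<Sum>l<d. (U $$ (k, j) * complex_of_real (x j) * cnj (U $$ (l, j))) * v $ l * cnj (w $ k))
      = complex_of_real (x j) * ((v \<bullet>c col U j) * cnj (w \<bullet>c col U j))"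
      unfolding ip[OF j]
      by (simp add: sum_distrib_left sum_distrib_right mult_ac)
  qed
  finally show ?thesis .
qed

lemma unitary_conj_one:
  assumes "unitary_mat d U"
  shows "unitary_conj d U (\<lambda>_. 1) = 1\<^sub>m d"
  using unitary_conj_carrier[OF assms, of "\<lambda>_. 1"]
  by (intro eq_matI) (auto simp: unitary_conj_index[OF assms] unitary_mat_rows[OF assms])

lemma parseval:
  assumes U: "unitary_mat d U" and v: "v \<in> carrier_vec d"
  shows "(\<Sum>j<d. (cmod (v \<bullet>c col U j))\<^sup>2) = Re (v \<bullet>c v)"
proof -
  have "v \<bullet>c v = (\<Sum>j<d. (v \<bullet>c col U j) * cnj (v \<bullet>c col U j))"
    using unitary_conj_cscalar_prod[OF U v v, of "\<lambda>_. 1"] v by (simp add: unitary_conj_one[OF U])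
  also have "\<dots> = complex_of_real (\<Sum>j<d. (cmod (v \<bullet>c col U j))\<^sup>2)"
    by (simp add: complex_norm_square[symmetric])
  finally show ?thesis by simp
qed

section \<open>Quadratic forms and traces\<close>

text \<open>For Hermitian \<open>A\<close> the inner product is already real, so taking the real
  part loses nothing.\<close>

definition quad_form :: "complex mat \<Rightarrow> complex vec \<Rightarrow> real" where
  "quad_form A v = Re ((A *\<^sub>v v) \<bullet>c v)"

lemma quad_form_unitary_conj:
  assumes U: "unitary_mat d U" and v: "v \<in> carrier_vec d"
  shows "quad_form (unitary_conj d U x) v = (\<Sum>j<d. x j * (cmod (v \<bullet>c col U j))\<^sup>2)"
  unfolding quad_form_def unitary_conj_cscalar_prod[OF U v v]
  by (simp add: complex_norm_square[symmetric] flip: of_real_power of_real_mult of_real_sum)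

lemma quad_form_add:
  assumes "A \<in> carrier_mat d d" "B \<in> carrier_mat d d" "v \<in> carrier_vec d"
  shows "quad_form (A + B) v = quad_form A v + quad_form B v"
  using assms unfolding quad_form_def
  by (subst add_mult_distrib_mat_vec[of _ d d]) (auto simp: add_scalar_prod_distrib[of _ d])

lemma quad_form_smult:
  assumes "A \<in> carrier_mat d d" "v \<in> carrier_vec d"
  shows "quad_form (complex_of_real c \<cdot>\<^sub>m A) v = c * quad_form A v"
proof -
  have "complex_of_real c \<cdot>\<^sub>m A *\<^sub>v v = complex_of_real c \<cdot>\<^sub>v (A *\<^sub>v v)"
    using assms by (intro eq_vecI) (auto simp: scalar_prod_def sum_distrib_left mult.assoc)
  then show ?thesis
    using assms unfolding quad_form_def by simp
qed

lemma quad_form_one: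
  assumes "v \<in> carrier_vec d"
  shows "quad_form (1\<^sub>m d) v = Re (v \<bullet>c v)"
  using assms by (simp add: quad_form_def)

text \<open>The trace does not depend on the orthonormal basis: once the sum over the basis index is
  innermost, orthonormality of the rows of \<open>U\<close> leaves only the diagonal entries of
  \<open>A\<close>.\<close>

lemma sum_quad_form_cols:
  assumes U: "unitary_mat d U" and A: "A \<in> carrier_mat d d"
  shows "(\<Sum>j<d. quad_form A (col U j)) = Re (mat_trace A)"
proof -
  have Uc: "U \<in> carrier_mat d d" using assms unitary_mat_carrier by auto
  have "(\<Sum>j<d. (A *\<^sub>v col U j) \<bullet>c col U j)
    = (\<Sum>j<d. \<Sum>k<d. \<Sum>l<d. A $$ (k, l) * (U $$ (l, j) * cnj (U $$ (k, j))))"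
    using A Uc by (simp add: cscalar_prod_sum[of _ d] mult_mat_vec_sum[OF A] 
        sum_distrib_right mult.assoc del: index_mult_mat_vec)
  also have "\<dots> = (\<Sum>k<d. \<Sum>j<d. \<Sum>l<d. A $$ (k, l) * (U $$ (l, j) * cnj (U $$ (k, j))))"
    by (rule sum.swap)
  also have "\<dots> = (\<Sum>k<d. \<Sum>l<d. \<Sum>j<d. A $$ (k, l) * (U $$ (l, j) * cnj (U $$ (k, j))))"
    by (intro sum.cong refl sum.swap)
  also have "\<dots> = (\<Sum>k<d. \<Sum>l<d. A $$ (k, l) * (if l = k then 1 else 0))"
    by (intro sum.cong refl) (simp add: unitary_mat_rows[OF U] flip: sum_distrib_left)
  also have "\<dots> = mat_trace A"
    using A by (simp add: mat_trace_def if_distrib cong: if_cong)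
  finally show ?thesis unfolding quad_form_def by (metis Re_sum)
qed

lemma mat_trace_unitary_conj:
  assumes U: "unitary_mat d U"
  shows "mat_trace (unitary_conj d U x) = complex_of_real (\<Sum>j<d. x j)"
proof -
  have "mat_trace (unitary_conj d U x)
      = (\<Sum>k<d. \<Sum>j<d. U $$ (k, j) * complex_of_real (x j) * cnj (U $$ (k, j)))"
    using carrier_matD[OF unitary_conj_carrier[OF U]]
    by (simp add: mat_trace_def unitary_conj_index[OF U])
  also have "\<dots> = (\<Sum>j<d. \<Sum>k<d. complex_of_real (x j) * (U $$ (k, j) * cnj (U $$ (k, j))))"
    by (subst sum.swap) (simp add: mult_ac)
  also have "\<dots> = (\<Sum>j<d. complex_of_real (x j))"
    by (intro sum.cong refl) (simp add: unitary_mat_cols[OF U] flip: sum_distrib_left)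
  finally show ?thesis by simp
qed

section \<open>The spectral theorem\<close>

lemma mat_adjoint_mult:
  fixes A B :: "complex mat"
  assumes A: "A \<in> carrier_mat n d" and B: "B \<in> carrier_mat d m"
  shows "mat_adjoint (A * B) = mat_adjoint B * mat_adjoint A"
proof (rule eq_matI)
  note A' = mat_adjoint_carrier[OF A] and B' = mat_adjoint_carrier[OF B]
  fix i j assume "i < dim_row (mat_adjoint B * mat_adjoint A)"
    "j < dim_col (mat_adjoint B * mat_adjoint A)"
  then have ij: "i < m" "j < n" using A B by auto
  then have "mat_adjoint (A * B) $$ (i, j) = cnj ((A * B) $$ (j, i))"
    using A B by (intro mat_adjoint_index) auto
  also have "\<dots> = (\<Sum>k<d. mat_adjoint B $$ (i, k) * mat_adjoint A $$ (k, j))"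
    using ij A B unfolding mult_mat_sum[OF A B ij(2,1)]
    by (simp add: mat_adjoint_index mult.commute)
  finally show "mat_adjoint (A * B) $$ (i, j) = (mat_adjoint B * mat_adjoint A) $$ (i, j)"
    unfolding mult_mat_sum[OF B' A' ij] .
qed (use A B in auto)

lemma mat_adjoint_adjoint:
  fixes A :: "complex mat"
  shows "mat_adjoint (mat_adjoint A) = A"
  by (rule eq_matI) (auto simp: mat_adjoint_index)

lemma unitary_mat_mult_adjoint:
  assumes "unitary_mat d U"
  shows "U * mat_adjoint U = 1\<^sub>m d"
  using assms mat_mult_left_right_inverse mat_adjoint_carrier unfolding unitary_mat_def by blast

lemma unitary_mat_mult:
  assumes W: "unitary_mat d W" and V: "unitary_mat d V"
  shows "unitary_mat d (W * V)"
    and "W * unitary_conj d V x * mat_adjoint W = unitary_conj d (W * V) x"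
proof -
  define D where "D = mat_diag d (\<lambda>i. complex_of_real (x i))"
  have c: "W \<in> carrier_mat d d" "V \<in> carrier_mat d d" "mat_adjoint W \<in> carrier_mat d d"
      "mat_adjoint V \<in> carrier_mat d d" "D \<in> carrier_mat d d"
    using W V by (auto simp: unitary_mat_def D_def intro: mat_adjoint_carrier)
  note a = assoc_mult_mat[where ?n\<^sub>1.0 = d and ?n\<^sub>2.0 = d and ?n\<^sub>3.0 = d and ?n\<^sub>4.0 = d]
    mult_carrier_mat[where nr = d and n = d and nc = d]
  have "mat_adjoint (W * V) * (W * V) = mat_adjoint V * ((mat_adjoint W * W) * V)"
    using c unfolding mat_adjoint_mult[OF c(1,2)] by (simp add: a)
  also have "\<dots> = 1\<^sub>m d"
    using W V c unfolding unitary_mat_def by simp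
  finally show "unitary_mat d (W * V)"
    using c unfolding unitary_mat_def by auto
  show "W * unitary_conj d V x * mat_adjoint W = unitary_conj d (W * V) x"
    using c unfolding unitary_conj_def mat_adjoint_mult[OF c(1,2)] D_def[symmetric] by (simp add: a)
qed

text \<open>Complete \<open>v\<close> to a basis and orthogonalise. Gram-Schmidt keeps the first
  vector, so normalising only rescales it.\<close>

lemma unitary_mat_with_first_col:
  fixes v :: "complex vec"
  assumes v: "v \<in> carrier_vec n" and v0: "v \<noteq> 0\<^sub>v n" and n: "0 < n"
  obtains W c where "unitary_mat n W" "col W 0 = c \<cdot>\<^sub>v v"
proof -
  interpret cof_vec_space n "TYPE(complex)" .
  define b where "b = basis_completion v"
  define ws where "ws = gram_schmidt n b"
  from basis_completion[OF v v0, folded b_def]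
  have dist_b: "distinct b" and indep: "\<not> lin_dep (set b)" and b: "set b \<subseteq> carrier_vec n"
    and hdb: "hd b = v" and len_b: "length b = n" by auto
  from hdb len_b n obtain vs where bv: "b = v # vs" by (cases b, auto)
  from gram_schmidt_result[OF b dist_b indep refl, folded ws_def]
  have ws: "set ws \<subseteq> carrier_vec n" "corthogonal ws" "length ws = n"
    by (auto simp: len_b)
  have "hd ws = v" using gram_schmidt_hd[OF v, of vs, folded bv] unfolding ws_def .
  then have ws0: "ws ! 0 = v" using ws(3) n by (cases ws) auto
  have wsc: "ws ! j \<in> carrier_vec n" if "j < n" for j using ws that by auto
  define N where "N j = complex_of_real (sqrt (Re (ws ! j \<bullet>c ws ! j)))" for j
  define W where "W = mat n n (\<lambda>(k, j). ws ! j $ k / N j)"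
  have W: "W \<in> carrier_mat n n" by (simp add: W_def)
  have norm: "ws ! j \<bullet>c ws ! j = N j * N j" "N j \<noteq> 0" "cnj (N j) = N j" if j: "j < n" for j
  proof -
    define r where "r = (\<Sum>k<n. (cmod (ws ! j $ k))\<^sup>2)"
    have eq: "ws ! j \<bullet>c ws ! j = complex_of_real r"
      unfolding cscalar_prod_sum[OF wsc[OF j]] r_def
      by (simp add: complex_norm_square[symmetric])
    have "r \<ge> 0" unfolding r_def by (simp add: sum_nonneg)
    then have "complex_of_real (sqrt r) * complex_of_real (sqrt r) = complex_of_real r"
      by (metis of_real_mult real_sqrt_mult_self abs_of_nonneg)
    then show 1: "ws ! j \<bullet>c ws ! j = N j * N j" unfolding N_def eq by simp
    \<comment> \<open>Besides orthogonality, \<open>corthogonal\<close> says that no vector is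
      orthogonal to itself, so the norms may be divided by.\<close>
    have "ws ! j \<bullet>c ws ! j \<noteq> 0" using corthogonalD[OF ws(2)] j ws(3) by auto
    then show "N j \<noteq> 0" using 1 by auto
    show "cnj (N j) = N j" by (simp add: N_def)
  qed
  have "unitary_mat n W"
  proof (rule unitary_matI[OF W])
    fix i j assume ij: "i < n" "j < n"
    have "(\<Sum>k<n. W $$ (k, i) * cnj (W $$ (k, j))) = (ws ! i \<bullet>c ws ! j) / (N i * N j)"
      using ij norm(3)[OF ij(2)] unfolding cscalar_prod_sum[OF wsc[OF ij(2)]]
      by (simp add: W_def sum_divide_distrib)
    also have "\<dots> = (if i = j then 1 else 0)"
      using norm(1,2)[OF ij(1)] corthogonalD[OF ws(2), of i j] ij ws(3) by auto
    finally show "(\<Sum>k<n. W $$ (k, i) * cnj (W $$ (k, j))) = (if i = j then 1 else 0)" .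
  qed
  moreover have "col W 0 = (1 / N 0) \<cdot>\<^sub>v v"
    using n v by (intro eq_vecI) (auto simp: W_def ws0)
  ultimately show ?thesis by (rule that)
qed

text \<open>Induction on the dimension by deflation: in an orthonormal basis starting with an
  eigenvector, the first column of the matrix vanishes below the diagonal, and by symmetry so does
  the rest of the first row. The remaining block is Hermitian of size \<open>n\<close>.\<close>

lemma hermitian_mat_spectral:
  assumes "hermitian_mat d A"
  obtains U x where "unitary_mat d U" "A = unitary_conj d U x"
proof -
  have "\<exists>U x. unitary_mat d U \<and> A = unitary_conj d U x"
    using assms
  proof (induction d arbitrary: A)
    case 0
    then have "A = unitary_conj 0 (1\<^sub>m 0) (\<lambda>_. 0)"
      by (intro eq_matI) (auto simp: hermitian_mat_def unitary_conj_def)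
    moreover have "unitary_mat 0 (1\<^sub>m 0)" by (rule unitary_matI) auto
    ultimately show ?case by blast
  next
    case (Suc n)
    let ?m = "Suc n"
    have A: "A \<in> carrier_mat ?m ?m" and adjA: "mat_adjoint A = A"
      using Suc.prems unfolding hermitian_mat_def by blast+
    obtain \<mu> where "eigenvalue A \<mu>"
      using spectrum_non_empty[OF A] by (auto simp: spectrum_def)
    then obtain v where v: "v \<in> carrier_vec ?m" "v \<noteq> 0\<^sub>v ?m" and Av: "A *\<^sub>v v = \<mu> \<cdot>\<^sub>v v"
      using A unfolding eigenvalue_def eigenvector_def by auto
    obtain W c where W: "unitary_mat ?m W" and W0: "col W 0 = c \<cdot>\<^sub>v v"
      using unitary_mat_with_first_col[OF v] by auto
    define W' where "W' = mat_adjoint W"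
    have Wc: "W \<in> carrier_mat ?m ?m" and W'c: "W' \<in> carrier_mat ?m ?m" and W'W: "W' * W = 1\<^sub>m ?m"
      using W mat_adjoint_carrier[of W] unfolding unitary_mat_def W'_def by auto
    have WW': "W * W' = 1\<^sub>m ?m" using unitary_mat_mult_adjoint[OF W] by (simp add: W'_def)
    note a = assoc_mult_mat[where ?n\<^sub>1.0 = ?m and ?n\<^sub>2.0 = ?m and ?n\<^sub>3.0 = ?m and ?n\<^sub>4.0 = ?m]
      mult_carrier_mat[where nr = ?m and n = ?m and nc = ?m]
    define B where "B = W' * (A * W)"
    have B: "B \<in> carrier_mat ?m ?m" using A Wc W'c by (simp add: B_def)
    have "W * B * W' = (W * W') * (A * (W * W'))"
      using A Wc W'c unfolding B_def by (simp add: a)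
    also have "\<dots> = A" using A unfolding WW' by simp
    finally have AB: "W * B * W' = A" .
    have "mat_adjoint B = mat_adjoint (A * W) * W"
      unfolding B_def mat_adjoint_mult[OF W'c mult_carrier_mat[OF A Wc]]
      by (simp add: W'_def mat_adjoint_adjoint)
    also have "\<dots> = B"
      unfolding mat_adjoint_mult[OF A Wc] adjA B_def W'_def[symmetric] using A Wc W'c by (simp add: a)
    finally have hB: "hermitian_mat ?m B" using B by (simp add: hermitian_mat_def)
    have "col B 0 = W' *\<^sub>v (A *\<^sub>v col W 0)"
      unfolding B_def col_mult2[OF W'c mult_carrier_mat[OF A Wc] zero_less_Suc]
        col_mult2[OF A Wc zero_less_Suc] ..
    also have "A *\<^sub>v col W 0 = \<mu> \<cdot>\<^sub>v col W 0"
      unfolding W0 using A v Av by (simp add: mult_mat_vec smult_smult_assoc mult.commute)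
    also have "W' *\<^sub>v (\<mu> \<cdot>\<^sub>v col W 0) = \<mu> \<cdot>\<^sub>v (W' *\<^sub>v col W 0)"
      using W'c col_unitary_carrier[OF W] by (intro mult_mat_vec) auto
    also have "W' *\<^sub>v col W 0 = col (W' * W) 0"
      by (rule col_mult2[OF W'c Wc zero_less_Suc, symmetric])
    finally have colB: "col B 0 = \<mu> \<cdot>\<^sub>v unit_vec ?m 0" unfolding W'W by simp
    have B0: "B $$ (i, 0) = (if i = 0 then \<mu> else 0)" if "i < ?m" for i
      using arg_cong[OF colB, of "\<lambda>u. u $ i"] that B by simp
    have B0': "B $$ (0, i) = (if i = 0 then cnj \<mu> else 0)" if "i < ?m" for i
      using hermitian_mat_index[OF hB, of 0 i] B0[OF that] that by simp
    \<comment> \<open>Row and column both determine the corner entry, which forces the eigenvalue to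
      be real.\<close>
    have "cnj \<mu> = \<mu>" using B0[of 0] B0'[of 0] by simp
    then have mu: "\<mu> = complex_of_real (Re \<mu>)" by (simp add: complex_eq_iff)
    define C where "C = mat n n (\<lambda>(i, j). B $$ (Suc i, Suc j))"
    have "hermitian_mat n C"
    proof (rule hermitian_matI)
      fix i j assume "i < n" "j < n"
      then show "C $$ (i, j) = cnj (C $$ (j, i))"
        using hermitian_mat_index[OF hB, of "Suc i" "Suc j"] by (simp add: C_def)
    qed (simp add: C_def)
    from Suc.IH[OF this] obtain V y where V: "unitary_mat n V" and CV: "C = unitary_conj n V y"
      by blast
    \<comment> \<open>\<open>V'\<close> is the block matrix diag(1, \<open>V\<close>), which
      diagonalises \<open>B\<close> without disturbing the split-off eigenvector.\<close>
    define V' where "V' = mat ?m ?m (\<lambda>(i, j). if i = 0 \<or> j = 0 then (if i = j then 1 else 0)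
      else V $$ (i - 1, j - 1))"
    define x where "x j = (if j = 0 then Re \<mu> else y (j - 1))" for j
    have V': "unitary_mat ?m V'"
    proof (rule unitary_matI)
      fix i j assume ij: "i < ?m" "j < ?m"
      show "(\<Sum>k<?m. V' $$ (k, i) * cnj (V' $$ (k, j))) = (if i = j then 1 else 0)"
      proof (cases "i = 0 \<or> j = 0")
        case True
        then show ?thesis
          using ij unfolding sum.lessThan_Suc_shift by (auto simp: V'_def)
      next
        case False
        then obtain i' j' where "i = Suc i'" "j = Suc j'" by (meson not0_implies_Suc)
        then show ?thesis
          using ij unitary_mat_cols[OF V, of i' j'] unfolding sum.lessThan_Suc_shift
          by (simp add: V'_def)
      qed
    qed (simp add: V'_def)
    have "B = unitary_conj ?m V' x"
    proof (rule eq_matI)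
      fix i j assume "i < dim_row (unitary_conj ?m V' x)" "j < dim_col (unitary_conj ?m V' x)"
      then have ij: "i < ?m" "j < ?m" using carrier_matD[OF unitary_conj_carrier[OF V', of x]] by auto
      show "B $$ (i, j) = unitary_conj ?m V' x $$ (i, j)"
      proof (cases "i = 0 \<or> j = 0")
        case True
        then show ?thesis
          using ij B0[of i] B0'[of j] mu unfolding unitary_conj_index[OF V' ij] sum.lessThan_Suc_shift
          by (auto simp: V'_def x_def)
      next
        case False
        then obtain i' j' where e: "i = Suc i'" "j = Suc j'" by (meson not0_implies_Suc)
        then have "B $$ (i, j) = unitary_conj n V y $$ (i', j')"
          using ij unfolding CV[symmetric] by (simp add: C_def)
        then show ?thesis
          using ij e unfolding unitary_conj_index[OF V' ij] sum.lessThan_Suc_shift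
          by (simp add: V'_def x_def unitary_conj_index[OF V])
      qed
    qed (use B carrier_matD[OF unitary_conj_carrier[OF V', of x]] in auto)
    then have "A = unitary_conj ?m (W * V') x"
      using AB unitary_mat_mult(2)[OF W V', of x] unfolding W'_def by simp
    then show ?case using unitary_mat_mult(1)[OF W V'] by blast
  qed
  then show ?thesis using that by blast
qed

section \<open>Eigenvalues, supports and Bessel's inequality\<close>

lemma cscalar_prod_commute:
  fixes v w :: "complex vec"
  assumes "v \<in> carrier_vec d" "w \<in> carrier_vec d"
  shows "v \<bullet>c w = cnj (w \<bullet>c v)"
  using assms by (simp add: cscalar_prod_sum[of _ d] mult.commute)

lemma cmod_cscalar_prod_commute:
  assumes "v \<in> carrier_vec d" "w \<in> carrier_vec d"
  shows "cmod (v \<bullet>c w) = cmod (w \<bullet>c v)"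
  using cscalar_prod_commute[OF assms] by (metis complex_mod_cnj)

lemma unitary_conj_mult_vec:
  assumes U: "unitary_mat d U" and v: "v \<in> carrier_vec d"
  shows "unitary_conj d U x *\<^sub>v v \<in> carrier_vec d"
    and "j < d \<Longrightarrow> (unitary_conj d U x *\<^sub>v v) \<bullet>c col U j = complex_of_real (x j) * (v \<bullet>c col U j)"
proof -
  show "unitary_conj d U x *\<^sub>v v \<in> carrier_vec d"
    using unitary_conj_carrier[OF U] v by (rule mult_mat_vec_carrier)
  assume j: "j < d"
  have "(unitary_conj d U x *\<^sub>v v) \<bullet>c col U j
    = (\<Sum>i<d. complex_of_real (x i) * ((v \<bullet>c col U i) * (if j = i then 1 else 0)))"
    unfolding unitary_conj_cscalar_prod[OF U v col_unitary_carrier[OF U j]]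
    using col_unitary_cscalar_prod[OF U j] by (intro sum.cong refl) auto
  also have "\<dots> = complex_of_real (x j) * (v \<bullet>c col U j)"
    using j by (simp add: if_distrib cong: if_cong)
  finally show "(unitary_conj d U x *\<^sub>v v) \<bullet>c col U j = complex_of_real (x j) * (v \<bullet>c col U j)" .
qed

lemma unitary_conj_mult_col:
  assumes U: "unitary_mat d U" and j: "j < d"
  shows "unitary_conj d U x *\<^sub>v col U j = complex_of_real (x j) \<cdot>\<^sub>v col U j"
proof (rule eq_vecI)
  note u = col_unitary_carrier[OF U j]
  fix k assume "k < dim_vec (complex_of_real (x j) \<cdot>\<^sub>v col U j)"
  then have k: "k < d" using unitary_mat_carrier[OF U] by auto
  \<comment> \<open>Reading coordinates as inner products makes the sesquilinear expansion
    applicable.\<close>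
  have e: "v $ k = v \<bullet>c unit_vec d k" if "v \<in> carrier_vec d" for v :: "complex vec"
    using that k by (simp add: cscalar_prod_sum[of _ d] if_distrib sum.delta cong: if_cong)
  have "(unitary_conj d U x *\<^sub>v col U j) $ k
     = (\<Sum>i<d. complex_of_real (x i) * ((if j = i then 1 else 0) * cnj (unit_vec d k \<bullet>c col U i)))"
    unfolding e[OF unitary_conj_mult_vec(1)[OF U u]]
      unitary_conj_cscalar_prod[OF U u unit_vec_carrier]
    using col_unitary_cscalar_prod[OF U j] by (intro sum.cong refl) auto
  also have "\<dots> = complex_of_real (x j) * cnj (unit_vec d k \<bullet>c col U j)"
    using j by (simp add: if_distrib if_distribR cong: if_cong)
  also have "\<dots> = complex_of_real (x j) * col U j $ k"
    unfolding e[OF u] using cscalar_prod_commute[OF u unit_vec_carrier, of k] by simp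
  finally show "(unitary_conj d U x *\<^sub>v col U j) $ k = (complex_of_real (x j) \<cdot>\<^sub>v col U j) $ k"
    using k unitary_mat_carrier[OF U] by simp
qed (use carrier_matD[OF unitary_conj_carrier[OF U, of x]] unitary_mat_carrier[OF U] in auto)

lemma quad_form_unitary_conj_col:
  assumes U: "unitary_mat d U" and j: "j < d"
  shows "quad_form (unitary_conj d U x) (col U j) = x j"
  using col_unitary_cscalar_prod[OF U j j] col_unitary_carrier[OF U j]
  unfolding quad_form_def unitary_conj_mult_col[OF U j] by simp

lemma le_lambda_max:
  assumes U: "unitary_mat d U" and j: "j < d"
  shows "x j \<le> lambda_max (unitary_conj d U x)"
proof -
  let ?A = "unitary_conj d U x" and ?S = "{y. complex_of_real y \<in> spectrum (unitary_conj d U x)}"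
  have A: "?A \<in> carrier_mat d d" using unitary_conj_carrier[OF U] .
  have "col U j \<noteq> 0\<^sub>v d"
    using col_unitary_cscalar_prod[OF U j j] col_unitary_carrier[OF U j] by auto
  then have "eigenvector ?A (col U j) (complex_of_real (x j))"
    unfolding eigenvector_def unitary_conj_mult_col[OF U j] using A col_unitary_carrier[OF U j] by auto
  then have "x j \<in> ?S" unfolding spectrum_def eigenvalue_def by auto
  \<comment> \<open>\<open>Max\<close> bounds its elements only on a finite set.\<close>
  moreover have "finite ?S"
    using finite_vimageI[OF card_finite_spectrum(1)[OF A], of complex_of_real]
    by (simp add: vimage_def inj_on_def)
  ultimately show ?thesis unfolding lambda_max_def by (rule Max_ge[rotated])
qed

text \<open>If \<open>w\<close> is in the kernel, its coefficient along an eigenvector is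
  annihilated by the eigenvalue, hence is 0 when the eigenvalue is not.\<close>

lemma unitary_conj_col_mem_support:
  assumes U: "unitary_mat d U" and j: "j < d" and xj: "x j \<noteq> 0"
  shows "col U j \<in> mat_support d (unitary_conj d U x)"
proof -
  have "col U j \<bullet>c w = 0" if w: "w \<in> mat_kernel (unitary_conj d U x)" for w
  proof -
    have wc: "w \<in> carrier_vec d" and "unitary_conj d U x *\<^sub>v w = 0\<^sub>v d"
      using mat_kernelD[OF unitary_conj_carrier[OF U] w] by auto
    then have "complex_of_real (x j) * (w \<bullet>c col U j) = 0"
      using unitary_conj_mult_vec(2)[OF U wc j, of x] col_unitary_carrier[OF U j] by simp
    then show ?thesis
      using xj cscalar_prod_commute[OF col_unitary_carrier[OF U j] wc] by simp
  qed
  then show ?thesis using col_unitary_carrier[OF U j] unfolding mat_support_def by auto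
qed

text \<open>The part of \<open>v\<close> orthogonal to the columns of \<open>U\<close> in \<open>J\<close> has the same inner products with the
  columns of \<open>W\<close> in \<open>K\<close> as \<open>v\<close> itself.\<close>

lemma bessel_orthogonal:
  assumes U: "unitary_mat d U" and W: "unitary_mat d W" and v: "v \<in> carrier_vec d"
    and J: "J \<subseteq> {..<d}" and K: "K \<subseteq> {..<d}"
    and orth: "\<And>j k. j \<in> J \<Longrightarrow> k \<in> K \<Longrightarrow> col U j \<bullet>c col W k = 0"
  shows "(\<Sum>j\<in>J. (cmod (v \<bullet>c col U j))\<^sup>2) + (\<Sum>k\<in>K. (cmod (v \<bullet>c col W k))\<^sup>2) \<le> Re (v \<bullet>c v)"
proof -
  define f :: "nat \<Rightarrow> real" where "f j = (if j \<in> J then 0 else 1)" for j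
  define y where "y = unitary_conj d U f *\<^sub>v v"
  have y: "y \<in> carrier_vec d" unfolding y_def by (rule unitary_conj_mult_vec(1)[OF U v])
  have yk: "y \<bullet>c col W k = v \<bullet>c col W k" if k: "k \<in> K" for k
  proof -
    have kd: "k < d" using K k by auto
    note w = col_unitary_carrier[OF W kd]
    have "complex_of_real (f j) * ((v \<bullet>c col U j) * cnj (col W k \<bullet>c col U j))
        = complex_of_real 1 * ((v \<bullet>c col U j) * cnj (col W k \<bullet>c col U j))" if "j < d" for j
      using orth[OF _ k, of j] cscalar_prod_commute[OF col_unitary_carrier[OF U that] w]
      by (auto simp: f_def)
    then have "y \<bullet>c col W k = (unitary_conj d U (\<lambda>_. 1) *\<^sub>v v) \<bullet>c col W k"
      unfolding y_def unitary_conj_cscalar_prod[OF U v w] by (intro sum.cong refl) simp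
    then show ?thesis using v by (simp add: unitary_conj_one[OF U])
  qed
  have "(\<Sum>k\<in>K. (cmod (v \<bullet>c col W k))\<^sup>2) = (\<Sum>k\<in>K. (cmod (y \<bullet>c col W k))\<^sup>2)"
    using yk by simp
  also have "\<dots> \<le> (\<Sum>k<d. (cmod (y \<bullet>c col W k))\<^sup>2)"
    using K by (intro sum_mono2) auto
  also have "\<dots> = (\<Sum>j<d. (cmod (y \<bullet>c col U j))\<^sup>2)"
    unfolding parseval[OF W y] parseval[OF U y] ..
  also have "\<dots> = (\<Sum>j<d. if j \<in> J then 0 else (cmod (v \<bullet>c col U j))\<^sup>2)"
    unfolding y_def by (intro sum.cong refl) (simp add: unitary_conj_mult_vec(2)[OF U v] f_def)
  also have "\<dots> = (\<Sum>j\<in>{..<d} - J. (cmod (v \<bullet>c col U j))\<^sup>2)"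
    by (intro sum.mono_neutral_cong_right) auto
  finally have "(\<Sum>j\<in>J. (cmod (v \<bullet>c col U j))\<^sup>2) + (\<Sum>k\<in>K. (cmod (v \<bullet>c col W k))\<^sup>2)
      \<le> (\<Sum>j<d. (cmod (v \<bullet>c col U j))\<^sup>2)"
    using sum.subset_diff[OF J, of "\<lambda>j. (cmod (v \<bullet>c col U j))\<^sup>2"] by simp
  then show ?thesis unfolding parseval[OF U v] .
qed

section \<open>Positive matrices and mass on orthogonal families\<close>

lemma psd_mat_spectral:
  assumes "psd_mat d A"
  obtains U x where "unitary_mat d U" "A = unitary_conj d U x" "\<And>j. j < d \<Longrightarrow> x j \<ge> 0"
proof -
  obtain U x where U: "unitary_mat d U" and A: "A = unitary_conj d U x"
    using hermitian_mat_spectral assms unfolding psd_mat_def by metis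
  have "x j \<ge> 0" if "j < d" for j
    using assms quad_form_unitary_conj_col[OF U that, of x] col_unitary_carrier[OF U that]
    unfolding psd_mat_def A quad_form_def by metis
  then show ?thesis using that U A by blast
qed

lemma psd_mat_quad_form: "psd_mat d A \<Longrightarrow> v \<in> carrier_vec d \<Longrightarrow> quad_form A v \<ge> 0"
  by (simp add: psd_mat_def quad_form_def)

text \<open>Bessel's inequality for each eigenvector of \<open>A\<close>, averaged with the
  nonnegative eigenvalues as weights. For the identity it compares ranks with the dimension; for a
  state it bounds the mass that two orthogonal subspaces can carry together.\<close>

lemma sum_quad_form_orthogonal_le_trace:
  assumes A: "psd_mat d A" and U: "unitary_mat d U" and W: "unitary_mat d W"
    and J: "J \<subseteq> {..<d}" and K: "K \<subseteq> {..<d}"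
    and orth: "\<And>j k. j \<in> J \<Longrightarrow> k \<in> K \<Longrightarrow> col U j \<bullet>c col W k = 0"
  shows "(\<Sum>j\<in>J. quad_form A (col U j)) + (\<Sum>k\<in>K. quad_form A (col W k)) \<le> Re (mat_trace A)"
proof -
  obtain V x where V: "unitary_mat d V" and AV: "A = unitary_conj d V x"
    and x: "\<And>i. i < d \<Longrightarrow> x i \<ge> 0" using psd_mat_spectral[OF A] by blast
  have qf: "(\<Sum>j\<in>J. quad_form A (col U j)) = (\<Sum>i<d. x i * (\<Sum>j\<in>J. (cmod (col V i \<bullet>c col U j))\<^sup>2))"
    if U: "unitary_mat d U" and J: "J \<subseteq> {..<d}" for U J
  proof -
    have "(\<Sum>j\<in>J. quad_form A (col U j)) = (\<Sum>j\<in>J. \<Sum>i<d. x i * (cmod (col V i \<bullet>c col U j))\<^sup>2)"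
    proof (intro sum.cong refl)
      fix j assume "j \<in> J"
      then have u: "col U j \<in> carrier_vec d" using J col_unitary_carrier[OF U] by auto
      show "quad_form A (col U j) = (\<Sum>i<d. x i * (cmod (col V i \<bullet>c col U j))\<^sup>2)"
        unfolding AV quad_form_unitary_conj[OF V u]
        by (intro sum.cong refl) (simp add: cmod_cscalar_prod_commute[OF u col_unitary_carrier[OF V]])
    qed
    also have "\<dots> = (\<Sum>i<d. \<Sum>j\<in>J. x i * (cmod (col V i \<bullet>c col U j))\<^sup>2)" by (rule sum.swap)
    finally show ?thesis by (simp add: sum_distrib_left)
  qed
  have "(\<Sum>j\<in>J. quad_form A (col U j)) + (\<Sum>k\<in>K. quad_form A (col W k))
    = (\<Sum>i<d. x i * ((\<Sum>j\<in>J. (cmod (col V i \<bullet>c col U j))\<^sup>2) + (\<Sum>k\<in>K. (cmod (col V i \<bullet>c col W k))\<^sup>2)))"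
    unfolding qf[OF U J] qf[OF W K] by (simp add: sum.distrib distrib_left)
  also have "\<dots> \<le> (\<Sum>i<d. x i * 1)"
  proof (intro sum_mono mult_left_mono)
    fix i assume "i \<in> {..<d}"
    then have i: "i < d" by simp
    show "(\<Sum>j\<in>J. (cmod (col V i \<bullet>c col U j))\<^sup>2) + (\<Sum>k\<in>K. (cmod (col V i \<bullet>c col W k))\<^sup>2) \<le> 1"
      using bessel_orthogonal[OF U W col_unitary_carrier[OF V i] J K orth]
        col_unitary_cscalar_prod[OF V i i] by simp
    show "0 \<le> x i" using x i .
  qed
  also have "\<dots> = Re (mat_trace A)" unfolding AV mat_trace_unitary_conj[OF V] by simp
  finally show ?thesis .
qed

section \<open>Entropy and Klein's inequality\<close>

definition trace_fun :: "nat \<Rightarrow> (real \<Rightarrow> real) \<Rightarrow> complex mat \<Rightarrow> real" where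
  "trace_fun d f A = Re (mat_trace (mat_fun d f A))"

lemma trace_fun_unitary_conj:
  assumes "unitary_mat d U"
  shows "trace_fun d f (unitary_conj d U x) = (\<Sum>j<d. f (x j))"
  unfolding trace_fun_def mat_fun_unitary_conj[OF assms] mat_trace_unitary_conj[OF assms] by simp

lemma unitary_conj_mult:
  assumes U: "unitary_mat d U"
  shows "unitary_conj d U x * unitary_conj d U y = unitary_conj d U (\<lambda>i. x i * y i)"
proof -
  define D where "D z = mat_diag d (\<lambda>i. complex_of_real (z i))" for z :: "nat \<Rightarrow> real"
  have c: "U \<in> carrier_mat d d" "mat_adjoint U \<in> carrier_mat d d" "D z \<in> carrier_mat d d" for z
    using U by (auto simp: unitary_mat_def D_def intro: mat_adjoint_carrier)
  note a = assoc_mult_mat[where ?n\<^sub>1.0 = d and ?n\<^sub>2.0 = d and ?n\<^sub>3.0 = d and ?n\<^sub>4.0 = d]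
    mult_carrier_mat[where nr = d and n = d and nc = d]
    left_mult_one_mat[where nr = d and nc = d]
  have "unitary_conj d U x * unitary_conj d U y
      = U * (D x * ((mat_adjoint U * U) * (D y * mat_adjoint U)))"
    using c unfolding unitary_conj_def D_def[symmetric] by (simp add: a)
  also have "\<dots> = U * ((D x * D y) * mat_adjoint U)"
    using c U unfolding unitary_mat_def by (simp add: a)
  also have "D x * D y = D (\<lambda>i. x i * y i)"
    unfolding D_def by (simp add: mat_diag_diag)
  finally show ?thesis
    using c unfolding unitary_conj_def D_def[symmetric] by (simp add: a)
qed

lemma von_neumann_entropy_unitary_conj:
  assumes U: "unitary_mat d U"
  shows "von_neumann_entropy d (unitary_conj d U x) = (\<Sum>j<d. - (x j * ln (x j)))"
  unfolding von_neumann_entropy_def mat_fun_unitary_conj[OF U] unitary_conj_mult[OF U]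
    mat_trace_unitary_conj[OF U] by (simp add: sum_negf)

text \<open>The function \<eta> of the overview. The factor \<open>x\<close> makes it 0 at 0, as the
  convention for entropy requires.\<close>

definition neg_xlogx :: "real \<Rightarrow> real" where
  "neg_xlogx x = - (x * ln x)"

text \<open>Concavity: the graph lies below its tangent at \<open>s\<close>, by ln t \<le> t - 1 at
  t = \<open>s / x\<close>. For \<open>x = 0\<close> the right side equals \<open>s\<close>.\<close>

lemma neg_xlogx_tangent:
  assumes "x \<ge> 0" "s > 0"
  shows "neg_xlogx x \<le> neg_xlogx s + (- ln s - 1) * (x - s)"
proof (cases "x = 0")
  case False
  then have x: "x > 0" using assms by simp
  have "x * ln (s / x) \<le> x * (s / x - 1)"
    using x assms by (intro mult_left_mono ln_le_minus_one) auto
  then have "x * (ln s - ln x) \<le> s - x"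
    using x assms by (simp add: ln_div algebra_simps)
  then show ?thesis by (simp add: neg_xlogx_def algebra_simps)
qed (use assms in \<open>simp add: neg_xlogx_def algebra_simps\<close>)

text \<open>A first-order upper bound for the trace function at a matrix that need not commute with
  \<open>A\<close>. The scalar tangent inequality is applied to every pair of eigenvalues and
  averaged with the squared overlaps of the two eigenbases.\<close>

lemma klein_inequality:
  assumes A: "psd_mat d A" and V: "unitary_mat d V" and s: "\<And>j. j < d \<Longrightarrow> s j > 0"
  shows "trace_fun d neg_xlogx A \<le> trace_fun d neg_xlogx (unitary_conj d V s)
    + (\<Sum>j<d. (- ln (s j) - 1) * (quad_form A (col V j) - s j))"
proof -
  obtain U x where U: "unitary_mat d U" and AU: "A = unitary_conj d U x"
    and x: "\<And>i. i < d \<Longrightarrow> x i \<ge> 0" using psd_mat_spectral[OF A] by blast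
  \<comment> \<open>By Parseval in either basis the overlaps form a doubly stochastic matrix: row
    sums restore the trace function of \<open>A\<close>, column sums the tangent terms.\<close>
  define M where "M i j = (cmod (col U i \<bullet>c col V j))\<^sup>2" for i j
  have row: "(\<Sum>j<d. M i j) = 1" if "i < d" for i
    using parseval[OF V col_unitary_carrier[OF U that]] col_unitary_cscalar_prod[OF U that that]
    by (simp add: M_def)
  have M': "M i j = (cmod (col V j \<bullet>c col U i))\<^sup>2" if "i < d" "j < d" for i j
    unfolding M_def
    using cmod_cscalar_prod_commute[OF col_unitary_carrier[OF U that(1)] col_unitary_carrier[OF V that(2)]]
    by simp
  have col: "(\<Sum>i<d. M i j) = 1" if "j < d" for j
    using parseval[OF U col_unitary_carrier[OF V that]] col_unitary_cscalar_prod[OF V that that] that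
    by (simp add: M')
  have qf: "quad_form A (col V j) = (\<Sum>i<d. x i * M i j)" if "j < d" for j
    unfolding AU quad_form_unitary_conj[OF U col_unitary_carrier[OF V that]] using that by (simp add: M')
  have "trace_fun d neg_xlogx A = (\<Sum>i<d. neg_xlogx (x i) * (\<Sum>j<d. M i j))"
    unfolding AU trace_fun_unitary_conj[OF U] by (simp add: row)
  also have "\<dots> = (\<Sum>i<d. \<Sum>j<d. neg_xlogx (x i) * M i j)"
    by (simp add: sum_distrib_left)
  also have "\<dots> \<le> (\<Sum>i<d. \<Sum>j<d. (neg_xlogx (s j) + (- ln (s j) - 1) * (x i - s j)) * M i j)"
    using neg_xlogx_tangent x s by (intro sum_mono mult_right_mono) (auto simp: M_def)
  also have "\<dots> = (\<Sum>j<d. \<Sum>i<d. (neg_xlogx (s j) + (- ln (s j) - 1) * (x i - s j)) * M i j)"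
    by (rule sum.swap)
  also have "\<dots> = (\<Sum>j<d. neg_xlogx (s j) + (- ln (s j) - 1) * (quad_form A (col V j) - s j))"
  proof (intro sum.cong refl)
    fix j assume "j \<in> {..<d}"
    then have j: "j < d" by simp
    have "(\<Sum>i<d. (a + b * (x i - s j)) * M i j)
        = a * (\<Sum>i<d. M i j) + b * ((\<Sum>i<d. x i * M i j) - s j * (\<Sum>i<d. M i j))" for a b
      by (simp add: sum_distrib_left sum.distrib sum_subtractf algebra_simps)
    then show "(\<Sum>i<d. (neg_xlogx (s j) + (- ln (s j) - 1) * (x i - s j)) * M i j)
        = neg_xlogx (s j) + (- ln (s j) - 1) * (quad_form A (col V j) - s j)"
      unfolding col[OF j] qf[OF j] by simp
  qed
  finally show ?thesis unfolding trace_fun_unitary_conj[OF V] by (simp add: sum.distrib)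
qed

section \<open>Averages of logarithms and trace estimates\<close>

text \<open>Jensen's inequality for the logarithm, obtained from its tangent at \<open>T\<close>.
  Allowing any upper bound \<open>T\<close> of the mean lets later estimates of the mean be inserted
  directly.\<close>

lemma sum_mult_ln_le:
  fixes a t :: "'i \<Rightarrow> real"
  assumes a: "\<And>j. j \<in> I \<Longrightarrow> a j \<ge> 0" "sum a I = 1"
    and t: "\<And>j. j \<in> I \<Longrightarrow> t j > 0" and T: "(\<Sum>j\<in>I. a j * t j) \<le> T" "T > 0"
  shows "(\<Sum>j\<in>I. a j * ln (t j)) \<le> ln T"
proof -
  have "(\<Sum>j\<in>I. a j * ln (t j)) \<le> (\<Sum>j\<in>I. a j * (ln T + t j / T - 1))"
  proof (intro sum_mono mult_left_mono a)
    fix j assume "j \<in> I"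
    then show "ln (t j) \<le> ln T + t j / T - 1"
      using ln_le_minus_one[of "t j / T"] t[of j] T(2) by (simp add: ln_div)
  qed
  also have "\<dots> = (ln T - 1) * sum a I + (\<Sum>j\<in>I. a j * t j) / T"
    by (simp add: sum_distrib_left sum.distrib sum_subtractf sum_divide_distrib algebra_simps)
  also have "\<dots> \<le> ln T" using T a(2) by simp
  finally show ?thesis .
qed

text \<open>If \<open>Y\<close> is positive definite and \<open>Y \<ge> c R \<ge> 0\<close>, then \<open>Tr (R Y\<^sup>-\<^sup>1) \<le> rank R / c\<close>: testing
  \<open>Y \<ge> c R\<close> against \<open>Y\<^sup>-\<^sup>1 u\<close> for an eigenvector \<open>u\<close> of \<open>R\<close> bounds its contribution by \<open>1 / c\<close>.\<close>

lemma sum_quad_form_div_le_rank: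
  assumes U: "unitary_mat d U" and V: "unitary_mat d V"
    and p: "\<And>k. k < d \<Longrightarrow> p k \<ge> 0" and y: "\<And>j. j < d \<Longrightarrow> y j > 0" and c: "c > 0"
    and le: "\<And>v. v \<in> carrier_vec d \<Longrightarrow>
      c * quad_form (unitary_conj d U p) v \<le> quad_form (unitary_conj d V y) v"
  shows "(\<Sum>j<d. quad_form (unitary_conj d U p) (col V j) * (1 / y j)) \<le> real (card {k. k < d \<and> p k > 0}) / c"
proof -
  \<comment> \<open>\<open>z k\<close> is the diagonal entry of the inverse of the second matrix at
    the eigenvector \<open>col U k\<close> of the first, so the sum to be bounded equals \<Sum>
    \<open>p k * z k\<close>.\<close>
  define z where "z k = (\<Sum>j<d. (cmod (col U k \<bullet>c col V j))\<^sup>2 / y j)" for k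
  have "p k * z k \<le> (if p k > 0 then 1 / c else 0)" if k: "k < d" for k
  proof (cases "p k > 0")
    case True
    note u = col_unitary_carrier[OF U k]
    define w where "w = unitary_conj d V (\<lambda>j. 1 / y j) *\<^sub>v col U k"
    have w: "w \<in> carrier_vec d" unfolding w_def by (rule unitary_conj_mult_vec(1)[OF V u])
    have "w \<bullet>c col U k = complex_of_real (z k)"
      unfolding w_def unitary_conj_cscalar_prod[OF V u u] z_def
      by (simp add: complex_norm_square[symmetric])
    then have wu: "(cmod (w \<bullet>c col U k))\<^sup>2 = (z k)\<^sup>2" by simp
    have "quad_form (unitary_conj d V y) w = z k"
      unfolding quad_form_unitary_conj[OF V w] z_def
      using y unfolding w_def
      by (intro sum.cong refl)
        (force simp: unitary_conj_mult_vec(2)[OF V u] norm_mult norm_divide power_mult_distrib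
           power2_eq_square field_simps)
    moreover have "p k * (z k)\<^sup>2 \<le> quad_form (unitary_conj d U p) w"
      unfolding quad_form_unitary_conj[OF U w] wu[symmetric]
      using p k by (intro member_le_sum) auto
    ultimately have "c * (p k * (z k)\<^sup>2) \<le> z k"
      using le[OF w] mult_left_mono[of _ _ c] c by (metis less_imp_le order_trans)
    then have "c * (p k * z k) * z k \<le> 1 * z k" by (simp add: power2_eq_square mult_ac)
    moreover have "z k \<ge> 0" unfolding z_def using y by (intro sum_nonneg) (simp add: less_imp_le)
    ultimately have "c * (p k * z k) \<le> 1" by (cases "z k = 0") auto
    then show ?thesis using c True by (simp add: field_simps)
  next
    case False
    then show ?thesis using p[OF k] by simp
  qed
  then have "(\<Sum>k<d. p k * z k) \<le> (\<Sum>k<d. if p k > 0 then 1 / c else 0)"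
    by (intro sum_mono) auto
  also have "\<dots> = real (card {k. k < d \<and> p k > 0}) / c"
    by (simp flip: sum.inter_filter)
  finally have main: "(\<Sum>k<d. p k * z k) \<le> real (card {k. k < d \<and> p k > 0}) / c" .
  have "(\<Sum>j<d. quad_form (unitary_conj d U p) (col V j) * (1 / y j))
     = (\<Sum>j<d. \<Sum>k<d. p k * ((cmod (col U k \<bullet>c col V j))\<^sup>2 / y j))"
  proof (intro sum.cong refl)
    fix j assume "j \<in> {..<d}"
    then have v: "col V j \<in> carrier_vec d" using col_unitary_carrier[OF V] by auto
    show "quad_form (unitary_conj d U p) (col V j) * (1 / y j)
      = (\<Sum>k<d. p k * ((cmod (col U k \<bullet>c col V j))\<^sup>2 / y j))"
      unfolding quad_form_unitary_conj[OF U v] sum_distrib_right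
      by (intro sum.cong refl) (simp add: cmod_cscalar_prod_commute[OF v col_unitary_carrier[OF U]])
  qed
  also have "\<dots> = (\<Sum>k<d. \<Sum>j<d. p k * ((cmod (col U k \<bullet>c col V j))\<^sup>2 / y j))" by (rule sum.swap)
  also have "\<dots> = (\<Sum>k<d. p k * z k)" by (simp add: z_def sum_distrib_left)
  finally show ?thesis using main by simp
qed

text \<open>Both sides are the trace of the product of the two matrices, evaluated in the eigenbasis
  of one or of the other.\<close>

lemma sum_quad_form_mult:
  assumes U: "unitary_mat d U" and V: "unitary_mat d V"
  shows "(\<Sum>j<d. quad_form (unitary_conj d U q) (col V j) * s j)
    = (\<Sum>k<d. q k * quad_form (unitary_conj d V s) (col U k))"
proof -
  have "(\<Sum>j<d. quad_form (unitary_conj d U q) (col V j) * s j)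
     = (\<Sum>j<d. \<Sum>k<d. q k * (s j * (cmod (col U k \<bullet>c col V j))\<^sup>2))"
  proof (intro sum.cong refl)
    fix j assume "j \<in> {..<d}"
    then have v: "col V j \<in> carrier_vec d" using col_unitary_carrier[OF V] by auto
    show "quad_form (unitary_conj d U q) (col V j) * s j
      = (\<Sum>k<d. q k * (s j * (cmod (col U k \<bullet>c col V j))\<^sup>2))"
      unfolding quad_form_unitary_conj[OF U v] sum_distrib_right
      by (intro sum.cong refl) (simp add: cmod_cscalar_prod_commute[OF v col_unitary_carrier[OF U]])
  qed
  also have "\<dots> = (\<Sum>k<d. \<Sum>j<d. q k * (s j * (cmod (col U k \<bullet>c col V j))\<^sup>2))" by (rule sum.swap)
  also have "\<dots> = (\<Sum>k<d. q k * quad_form (unitary_conj d V s) (col U k))"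
  proof (intro sum.cong refl)
    fix k assume "k \<in> {..<d}"
    then have u: "col U k \<in> carrier_vec d" using col_unitary_carrier[OF U] by auto
    show "(\<Sum>j<d. q k * (s j * (cmod (col U k \<bullet>c col V j))\<^sup>2)) = q k * quad_form (unitary_conj d V s) (col U k)"
      unfolding quad_form_unitary_conj[OF V u] by (simp add: sum_distrib_left)
  qed
  finally show ?thesis .
qed

section \<open>Entropy along a linear path\<close>

lemma quad_form_add_smult:
  assumes "A \<in> carrier_mat d d" "B \<in> carrier_mat d d" "v \<in> carrier_vec d"
  shows "quad_form (A + complex_of_real c \<cdot>\<^sub>m B) v = quad_form A v + c * quad_form B v"
  using assms by (simp add: quad_form_add[of _ d] quad_form_smult[of _ d])

lemma psd_mat_carrier: "psd_mat d A \<Longrightarrow> A \<in> carrier_mat d d"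
  by (simp add: psd_mat_def hermitian_mat_def)

lemma psd_mat_add_smult:
  assumes A: "psd_mat d A" and B: "psd_mat d B" and c: "c \<ge> 0"
  shows "psd_mat d (A + complex_of_real c \<cdot>\<^sub>m B)"
proof -
  note AB = psd_mat_carrier[OF A] psd_mat_carrier[OF B]
  have "hermitian_mat d (A + complex_of_real c \<cdot>\<^sub>m B)"
  proof (rule hermitian_matI)
    fix i j assume ij: "i < d" "j < d"
    have "A $$ (i, j) = cnj (A $$ (j, i))" "B $$ (i, j) = cnj (B $$ (j, i))"
      using hermitian_mat_index[of d _ i j] A B ij unfolding psd_mat_def by blast+
    then show "(A + complex_of_real c \<cdot>\<^sub>m B) $$ (i, j) = cnj ((A + complex_of_real c \<cdot>\<^sub>m B) $$ (j, i))"
      using AB ij by simp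
  qed (use AB in simp)
  moreover have "quad_form (A + complex_of_real c \<cdot>\<^sub>m B) v \<ge> 0" if v: "v \<in> carrier_vec d" for v
    unfolding quad_form_add_smult[OF AB v] using psd_mat_quad_form[OF A v] psd_mat_quad_form[OF B v] c by simp
  ultimately show ?thesis unfolding psd_mat_def quad_form_def by blast
qed

lemma Re_cscalar_prod_self_ge_0:
  fixes v :: "complex vec"
  shows "Re (v \<bullet>c v) \<ge> 0"
  by (simp add: cscalar_prod_sum[of _ "dim_vec v"] sum_nonneg)

lemma psd_mat_one: "psd_mat d (1\<^sub>m d)"
proof -
  have "hermitian_mat d (1\<^sub>m d)" by (rule hermitian_matI) auto
  then show ?thesis unfolding psd_mat_def by (simp add: Re_cscalar_prod_self_ge_0)
qed

lemma density_mat_spectral: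
  assumes "density_mat d R"
  obtains U p where "unitary_mat d U" "R = unitary_conj d U p" "\<And>k. k < d \<Longrightarrow> p k \<ge> 0"
    "sum p {..<d} = 1"
proof -
  obtain U p where U: "unitary_mat d U" and R: "R = unitary_conj d U p" and "\<And>k. k < d \<Longrightarrow> p k \<ge> 0"
    using psd_mat_spectral assms unfolding density_mat_def by metis
  moreover have "complex_of_real (sum p {..<d}) = 1"
    using assms unfolding density_mat_def R mat_trace_unitary_conj[OF U] by blast
  then have "sum p {..<d} = 1" by (simp only: of_real_eq_1_iff)
  ultimately show ?thesis using that by blast
qed

text \<open>The shift by \<open>\<kappa> > 0\<close> makes all logarithms along the paths finite; it is removed in the end
  by \<open>\<kappa> \<rightarrow> 0\<close>.\<close>

definition regularize :: "nat \<Rightarrow> real \<Rightarrow> complex mat \<Rightarrow> complex mat" where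
  "regularize d \<kappa> A = A + complex_of_real \<kappa> \<cdot>\<^sub>m 1\<^sub>m d"

lemma regularize_unitary_conj:
  assumes U: "unitary_mat d U"
  shows "regularize d \<kappa> (unitary_conj d U x) = unitary_conj d U (\<lambda>i. x i + \<kappa>)"
proof (rule eq_matI)
  note c = unitary_conj_carrier[OF U]
  fix i j assume "i < dim_row (unitary_conj d U (\<lambda>i. x i + \<kappa>))"
    "j < dim_col (unitary_conj d U (\<lambda>i. x i + \<kappa>))"
  then have ij: "i < d" "j < d" using carrier_matD[OF c] by auto
  have "unitary_conj d U (\<lambda>i. x i + \<kappa>) $$ (i, j) = unitary_conj d U x $$ (i, j)
      + complex_of_real \<kappa> * (\<Sum>k<d. U $$ (i, k) * cnj (U $$ (j, k)))"
    unfolding unitary_conj_index[OF U ij]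
    by (simp add: sum.distrib sum_distrib_left algebra_simps)
  then show "regularize d \<kappa> (unitary_conj d U x) $$ (i, j) = unitary_conj d U (\<lambda>i. x i + \<kappa>) $$ (i, j)"
    unfolding unitary_mat_rows[OF U ij] regularize_def using ij carrier_matD[OF c, of x] by simp
qed (use carrier_matD[OF unitary_conj_carrier[OF U]] in \<open>auto simp: regularize_def\<close>)

text \<open>Each eigenvalue is the value of the form at a unit eigenvector. The shift contributes
  \<open>\<kappa>\<close> to it and the other two terms are nonnegative, hence strict
  positivity.\<close>

lemma regularized_path:
  assumes A: "psd_mat d A" and R: "psd_mat d R" and \<kappa>: "\<kappa> > 0" and u: "u \<ge> 0"
  defines "X \<equiv> regularize d \<kappa> A + complex_of_real u \<cdot>\<^sub>m R"
  shows "psd_mat d X"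
    and "v \<in> carrier_vec d \<Longrightarrow>
      quad_form X v = quad_form A v + \<kappa> * Re (v \<bullet>c v) + u * quad_form R v"
    and "\<exists>V s. unitary_mat d V \<and> X = unitary_conj d V s \<and> (\<forall>j<d. s j > 0)"
proof -
  have reg: "psd_mat d (regularize d \<kappa> A)"
    unfolding regularize_def using \<kappa> by (intro psd_mat_add_smult A psd_mat_one) simp
  show X: "psd_mat d X"
    unfolding X_def by (rule psd_mat_add_smult[OF reg R u])
  have qf: "quad_form X v = quad_form A v + \<kappa> * Re (v \<bullet>c v) + u * quad_form R v"
    if v: "v \<in> carrier_vec d" for v
    unfolding X_def quad_form_add_smult[OF psd_mat_carrier[OF reg] psd_mat_carrier[OF R] v]
    unfolding regularize_def quad_form_add_smult[OF psd_mat_carrier[OF A] one_carrier_mat v]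
      quad_form_one[OF v] ..
  then show "v \<in> carrier_vec d \<Longrightarrow>
      quad_form X v = quad_form A v + \<kappa> * Re (v \<bullet>c v) + u * quad_form R v" .
  obtain V s where V: "unitary_mat d V" and XV: "X = unitary_conj d V s"
    using psd_mat_spectral[OF X] by blast
  have "s j > 0" if j: "j < d" for j
  proof -
    note v = col_unitary_carrier[OF V j]
    have "s j = quad_form A (col V j) + \<kappa> + u * quad_form R (col V j)"
      using qf[OF v] quad_form_unitary_conj_col[OF V j, of s] col_unitary_cscalar_prod[OF V j j]
      unfolding XV by simp
    then show ?thesis
      using psd_mat_quad_form[OF A v] psd_mat_quad_form[OF R v] u \<kappa> by (smt (verit) mult_nonneg_nonneg)
  qed
  then show "\<exists>V s. unitary_mat d V \<and> X = unitary_conj d V s \<and> (\<forall>j<d. s j > 0)"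
    using V XV by blast
qed

text \<open>Klein's inequality between two points of one path: they differ by \<open>w - u\<close>
  times \<open>R\<close>, and \<open>R\<close> has trace one. The order of \<open>u\<close> and
  \<open>w\<close> is left open, so the tangent may be taken at either end of an increment.\<close>

lemma klein_path:
  assumes A: "psd_mat d A" and R: "density_mat d R" and \<kappa>: "\<kappa> > 0" and u: "u \<ge> 0" and w: "w \<ge> 0"
    and V: "unitary_mat d V" and s: "\<And>j. j < d \<Longrightarrow> s j > 0"
    and eq: "regularize d \<kappa> A + complex_of_real u \<cdot>\<^sub>m R = unitary_conj d V s"
  shows "trace_fun d neg_xlogx (regularize d \<kappa> A + complex_of_real w \<cdot>\<^sub>m R)
      - trace_fun d neg_xlogx (regularize d \<kappa> A + complex_of_real u \<cdot>\<^sub>m R)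
    \<le> (w - u) * ((\<Sum>j<d. quad_form R (col V j) * ln (1 / s j)) - 1)"
proof -
  have psdR: "psd_mat d R" using R by (simp add: density_mat_def)
  have "(- ln (s j) - 1) * (quad_form (regularize d \<kappa> A + complex_of_real w \<cdot>\<^sub>m R) (col V j) - s j)
    = (w - u) * (quad_form R (col V j) * ln (1 / s j) - quad_form R (col V j))" if j: "j < d" for j
  proof -
    note v = col_unitary_carrier[OF V j]
    have "s j = quad_form (regularize d \<kappa> A + complex_of_real u \<cdot>\<^sub>m R) (col V j)"
      unfolding eq quad_form_unitary_conj_col[OF V j] ..
    then have e: "quad_form (regularize d \<kappa> A + complex_of_real w \<cdot>\<^sub>m R) (col V j) - s j
        = (w - u) * quad_form R (col V j)"
      unfolding regularized_path(2)[OF A psdR \<kappa> u v] regularized_path(2)[OF A psdR \<kappa> w v]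
      by (simp add: algebra_simps)
    show ?thesis unfolding e using s[OF j] by (simp add: ln_div algebra_simps)
  qed
  then have "(\<Sum>j<d. (- ln (s j) - 1)
        * (quad_form (regularize d \<kappa> A + complex_of_real w \<cdot>\<^sub>m R) (col V j) - s j))
      = (\<Sum>j<d. (w - u) * (quad_form R (col V j) * ln (1 / s j) - quad_form R (col V j)))"
    by (intro sum.cong refl) auto
  moreover have "(\<Sum>j<d. quad_form R (col V j)) = 1"
    using sum_quad_form_cols[OF V psd_mat_carrier[OF psdR]] R by (simp add: density_mat_def)
  ultimately show ?thesis
    using klein_inequality[OF regularized_path(1)[OF A psdR \<kappa> w] V, of s] s unfolding eq
    by (simp add: sum_subtractf flip: sum_distrib_left)
qed

text \<open>The tangent is taken at the left end. There the matrix dominates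
  \<open>u + \<kappa>\<close> times the state, so the trace of the state against the inverse is at
  most \<open>n / (u + \<kappa>)\<close>, and Jensen's inequality moves the logarithm
  outside.\<close>

lemma trace_neg_xlogx_path_upper:
  assumes A: "psd_mat d A" and R: "density_mat d (unitary_conj d U p)" and \<kappa>: "\<kappa> > 0"
    and u: "0 \<le> u" "u < w"
    and U: "unitary_mat d U" and p: "\<And>k. k < d \<Longrightarrow> p k \<ge> 0" "sum p {..<d} = 1"
  defines "X \<equiv> \<lambda>u. regularize d \<kappa> A + complex_of_real u \<cdot>\<^sub>m unitary_conj d U p"
  defines "n \<equiv> real (card {k. k < d \<and> p k > 0})"
  shows "trace_fun d neg_xlogx (X w) - trace_fun d neg_xlogx (X u) \<le> (w - u) * (ln (n / (u + \<kappa>)) - 1)"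
proof -
  let ?R = "unitary_conj d U p"
  have psdR: "psd_mat d ?R" using R by (simp add: density_mat_def)
  obtain V s where V: "unitary_mat d V" and XV: "X u = unitary_conj d V s" and s: "\<And>j. j < d \<Longrightarrow> s j > 0"
    using regularized_path(3)[OF A psdR \<kappa> u(1)] unfolding X_def by blast
  have "p k \<le> 1" if "k < d" for k
    using member_le_sum[of k "{..<d}" p] p that by auto
  \<comment> \<open>A state is at most the identity, so the shift dominates \<open>\<kappa>\<close>
    times the state and improves the constant from \<open>u\<close> to
    \<open>u + \<kappa>\<close>.\<close>
  then have R1: "quad_form ?R v \<le> Re (v \<bullet>c v)" if v: "v \<in> carrier_vec d" for v
    unfolding quad_form_unitary_conj[OF U v] parseval[OF U v, symmetric]
    by (intro sum_mono) (simp add: mult_left_le_one_le p)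
  have le: "(u + \<kappa>) * quad_form ?R v \<le> quad_form (unitary_conj d V s) v" if v: "v \<in> carrier_vec d" for v
  proof -
    have "\<kappa> * quad_form ?R v \<le> \<kappa> * Re (v \<bullet>c v)"
      using R1[OF v] \<kappa> by (intro mult_left_mono) auto
    then show ?thesis
      using regularized_path(2)[OF A psdR \<kappa> u(1) v] psd_mat_quad_form[OF A v]
      unfolding XV[symmetric] X_def distrib_right by linarith
  qed
  \<comment> \<open>Unit trace forces a positive rank, so the logarithm of the bound has a positive
    argument.\<close>
  have "\<exists>k<d. p k > 0"
  proof (rule ccontr)
    assume "\<not> (\<exists>k<d. p k > 0)"
    then have "sum p {..<d} \<le> 0" by (intro sum_nonpos) (meson lessThan_iff not_less)
    then show False using p(2) by simp
  qed
  then have n: "n > 0" unfolding n_def by (auto simp: card_gt_0_iff)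
  have "(\<Sum>j<d. quad_form ?R (col V j) * ln (1 / s j)) \<le> ln (n / (u + \<kappa>))"
  proof (rule sum_mult_ln_le)
    show "(\<Sum>j<d. quad_form ?R (col V j) * (1 / s j)) \<le> n / (u + \<kappa>)"
      unfolding n_def using \<kappa> u by (intro sum_quad_form_div_le_rank[OF U V p(1) s _ le]) auto
    show "(\<Sum>j<d. quad_form ?R (col V j)) = 1"
      using sum_quad_form_cols[OF V psd_mat_carrier[OF psdR]] R by (simp add: density_mat_def)
  qed (use s n \<kappa> u psd_mat_quad_form[OF psdR col_unitary_carrier[OF V]] in auto)
  then have fin: "(w - u) * ((\<Sum>j<d. quad_form ?R (col V j) * ln (1 / s j)) - 1) \<le> (w - u) * (ln (n / (u + \<kappa>)) - 1)"
    using u by (intro mult_left_mono) auto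
  have w: "0 \<le> w" using u by simp
  show ?thesis
    unfolding X_def by (rule order_trans[OF klein_path[OF A R \<kappa> u(1) w V s XV[unfolded X_def]] fin])
qed

text \<open>Here the tangent is taken at the right end, with \<open>u\<close> as comparison point.
  Jensen's inequality is applied to the eigenvalues themselves, whose mean is the trace of the state
  against \<open>X w\<close>; \<open>T\<close> stands for any bound of it.\<close>

lemma trace_neg_xlogx_path_lower:
  assumes A: "psd_mat d A" and R: "density_mat d (unitary_conj d U q)" and \<kappa>: "\<kappa> > 0"
    and u: "0 \<le> u" "u < w" and U: "unitary_mat d U" 
  defines "X \<equiv> \<lambda>u. regularize d \<kappa> A + complex_of_real u \<cdot>\<^sub>m unitary_conj d U q"
  assumes T: "(\<Sum>k<d. q k * quad_form (X w) (col U k)) \<le> T" "T > 0"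
  shows "trace_fun d neg_xlogx (X u) - trace_fun d neg_xlogx (X w) \<le> (w - u) * (ln T + 1)"
proof -
  let ?R = "unitary_conj d U q"
  have psdR: "psd_mat d ?R" using R by (simp add: density_mat_def)
  have w: "0 \<le> w" using u by simp
  obtain V s where V: "unitary_mat d V" and XV: "X w = unitary_conj d V s" and s: "\<And>j. j < d \<Longrightarrow> s j > 0"
    using regularized_path(3)[OF A psdR \<kappa> w] unfolding X_def by blast
  have "(\<Sum>j<d. quad_form ?R (col V j) * ln (s j)) \<le> ln T"
  proof (rule sum_mult_ln_le)
    show "(\<Sum>j<d. quad_form ?R (col V j) * s j) \<le> T"
      using T(1) unfolding sum_quad_form_mult[OF U V] XV .
    show "(\<Sum>j<d. quad_form ?R (col V j)) = 1"
      using sum_quad_form_cols[OF V psd_mat_carrier[OF psdR]] R by (simp add: density_mat_def)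
  qed (use s T psd_mat_quad_form[OF psdR col_unitary_carrier[OF V]] in auto)
  moreover have "(\<Sum>j<d. quad_form ?R (col V j) * ln (1 / s j)) = - (\<Sum>j<d. quad_form ?R (col V j) * ln (s j))"
    unfolding sum_negf[symmetric] using s by (intro sum.cong refl) (force simp: ln_div)
  ultimately have fin: "(u - w) * ((\<Sum>j<d. quad_form ?R (col V j) * ln (1 / s j)) - 1) \<le> (w - u) * (ln T + 1)"
    using mult_left_mono[of "(\<Sum>j<d. quad_form ?R (col V j) * ln (s j))" "ln T" "w - u"] u
    by (simp add: algebra_simps)
  show ?thesis
    unfolding X_def by (rule order_trans[OF klein_path[OF A R \<kappa> w u(1) V s XV[unfolded X_def]] fin])
qed

text \<open>Right continuity, including the limit of x ln x at 0. The slope \<open>b\<close> covers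
  arguments shifted by a multiple of \<open>\<kappa>\<close>.\<close>

lemma neg_xlogx_tendsto:
  assumes "a \<ge> 0" "b \<ge> 0"
  shows "((\<lambda>\<kappa>. neg_xlogx (a + b * \<kappa>)) \<longlongrightarrow> neg_xlogx a) (at_right 0)"
proof -
  consider "a > 0" | "a = 0" "b = 0" | "a = 0" "b > 0" using assms by fastforce
  then show ?thesis
  proof cases
    case 1
    then show ?thesis unfolding neg_xlogx_def by (auto intro!: tendsto_eq_intros)
  next
    case 2
    then show ?thesis by simp
  next
    case 3
    then show ?thesis unfolding neg_xlogx_def by simp real_asymp
  qed
qed

section \<open>The entropy bound\<close>

text \<open>Discretised fundamental theorem of calculus: as \<open>g\<close> is monotone, the errors of the
  \<open>N\<close> increments telescope to \<open>\<epsilon> (g \<epsilon> - g 0) / N\<close>.\<close>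

lemma increment_bound_incr:
  fixes \<phi> G g :: "real \<Rightarrow> real"
  assumes "\<epsilon> \<ge> 0"
    and \<phi>: "\<And>u v. 0 \<le> u \<Longrightarrow> u < v \<Longrightarrow> v \<le> \<epsilon> \<Longrightarrow> \<phi> v - \<phi> u \<le> (v - u) * g v"
    and G: "\<And>u v. 0 \<le> u \<Longrightarrow> u < v \<Longrightarrow> v \<le> \<epsilon> \<Longrightarrow> (v - u) * g u \<le> G v - G u"
  shows "\<phi> \<epsilon> - \<phi> 0 \<le> G \<epsilon> - G 0"
proof (rule field_le_epsilon)
  fix e :: real assume e: "e > 0"
  \<comment> \<open>Fine enough that the accumulated error is below \<open>e\<close>;
    \<open>N\<close> must also be positive as it divides the interval.\<close>
  obtain N :: nat where N: "\<epsilon> * (g \<epsilon> - g 0) / e < real N" "0 < N"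
    by (metis reals_Archimedean2 gr0I less_le_trans of_nat_mono less_Suc_eq_le le_less_trans
      zero_less_Suc le_SucI order_refl)
  define t where "t k = \<epsilon> * real k / real N" for k :: nat
  define \<delta> where "\<delta> = \<epsilon> / real N"
  have \<delta>: "t (Suc k) - t k = \<delta>" for k by (simp add: t_def \<delta>_def add_divide_distrib distrib_left)
  have "(\<phi> (t k) - G (t k)) - (\<phi> (t 0) - G (t 0)) \<le> \<delta> * (g (t k) - g (t 0))" if "k \<le> N" for k
    using that
  proof (induction k)
    case (Suc k)
    have tk: "0 \<le> t k" "t (Suc k) \<le> \<epsilon>" "t k \<le> t (Suc k)"
      using Suc.prems assms(1) N(2)
      by (auto simp: t_def divide_simps mult_left_mono)
    \<comment> \<open>The hypotheses need distinct points. If the grid points coincide, as for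
      \<open>\<epsilon> = 0\<close>, both inequalities are trivial.\<close>
    have "\<phi> (t (Suc k)) - \<phi> (t k) \<le> \<delta> * g (t (Suc k))" "\<delta> * g (t k) \<le> G (t (Suc k)) - G (t k)"
      using \<phi>[of "t k" "t (Suc k)"] G[of "t k" "t (Suc k)"] tk \<delta>[of k] by (cases "t k = t (Suc k)"; simp)+
    then show ?case using Suc by (simp add: algebra_simps)
  qed simp
  from this[of N] have "(\<phi> \<epsilon> - G \<epsilon>) - (\<phi> 0 - G 0) \<le> \<delta> * (g \<epsilon> - g 0)"
    using N(2) by (simp add: t_def)
  also have "\<dots> \<le> e" using N e by (simp add: \<delta>_def field_simps)
  finally show "\<phi> \<epsilon> - \<phi> 0 \<le> G \<epsilon> - G 0 + e" by simp
qed

text \<open>Reflecting the interval by u \<mapsto> \<epsilon> - u and negating both functions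
  exchanges left and right endpoints, which reduces this to the previous case.\<close>

lemma increment_bound_decr:
  fixes \<phi> G g :: "real \<Rightarrow> real"
  assumes "\<epsilon> \<ge> 0"
    and \<phi>: "\<And>u v. 0 \<le> u \<Longrightarrow> u < v \<Longrightarrow> v \<le> \<epsilon> \<Longrightarrow> \<phi> v - \<phi> u \<le> (v - u) * g u"
    and G: "\<And>u v. 0 \<le> u \<Longrightarrow> u < v \<Longrightarrow> v \<le> \<epsilon> \<Longrightarrow> (v - u) * g v \<le> G v - G u"
  shows "\<phi> \<epsilon> - \<phi> 0 \<le> G \<epsilon> - G 0"
  using increment_bound_incr[of \<epsilon> "\<lambda>u. - \<phi> (\<epsilon> - u)" "\<lambda>u. g (\<epsilon> - u)" "\<lambda>u. - G (\<epsilon> - u)"]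
    \<phi>[of "\<epsilon> - _" "\<epsilon> - _"] G[of "\<epsilon> - _" "\<epsilon> - _"] assms(1) by simp

text \<open>One direction of the bound. \<open>\<Lambda>\<close> is only required to dominate
  \<open>lambda_max \<rho>m\<close>, so that the same maximum can be inserted after the roles of the
  states are exchanged.\<close>

lemma entropy_difference_le:
  assumes \<rho>1: "density_mat d \<rho>1" and \<rho>2: "density_mat d \<rho>2"
    and \<epsilon>: "0 \<le> \<epsilon>" "\<epsilon> \<le> 1"
    and \<rho>p: "density_mat d \<rho>p" and \<rho>m: "density_mat d \<rho>m"
    and orth: "orthogonal_supports d \<rho>p \<rho>m"
    and eq: "\<rho>1 - \<rho>2 = complex_of_real \<epsilon> \<cdot>\<^sub>m \<rho>p - complex_of_real \<epsilon> \<cdot>\<^sub>m \<rho>m"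
    and lam: "lambda_max \<rho>m \<le> \<Lambda>"
  shows "von_neumann_entropy d \<rho>1 - von_neumann_entropy d \<rho>2
    \<le> \<epsilon> * ln (real d * \<Lambda> - 1) + binary_entropy \<epsilon>"
proof -
  have psd: "psd_mat d \<rho>1" "psd_mat d \<rho>2" "psd_mat d \<rho>p" "psd_mat d \<rho>m"
    using \<rho>1 \<rho>2 \<rho>p \<rho>m by (auto simp: density_mat_def)
  note carr = psd[THEN psd_mat_carrier]
  obtain U p where U: "unitary_mat d U" and pU: "\<rho>p = unitary_conj d U p"
    and p: "\<And>k. k < d \<Longrightarrow> p k \<ge> 0" "sum p {..<d} = 1"
    using density_mat_spectral[OF \<rho>p] by blast
  obtain W q where W: "unitary_mat d W" and qW: "\<rho>m = unitary_conj d W q"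
    and q: "\<And>k. k < d \<Longrightarrow> q k \<ge> 0" "sum q {..<d} = 1"
    using density_mat_spectral[OF \<rho>m] by blast
  \<comment> \<open>\<open>J\<close> and \<open>K\<close> index the eigenvectors spanning the
    supports of \<open>\<rho>p\<close> and \<open>\<rho>m\<close>; \<open>np\<close> and
    \<open>nm\<close> are the ranks.\<close>
  define J where "J = {k. k < d \<and> p k > 0}"
  define K where "K = {k. k < d \<and> q k > 0}"
  define np where "np = real (card J)"
  define nm where "nm = real (card K)"
  have JK: "J \<subseteq> {..<d}" "K \<subseteq> {..<d}" by (auto simp: J_def K_def)
  have fin: "finite J" "finite K" using JK finite_subset by blast+
  have sumJ: "sum p J = 1"
    unfolding p(2)[symmetric] using JK p(1) by (intro sum.mono_neutral_left) (force simp: J_def not_less)+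
  have sumK: "sum q K = 1"
    unfolding q(2)[symmetric] using JK q(1) by (intro sum.mono_neutral_left) (force simp: K_def not_less)+
  have q_le: "q k \<le> \<Lambda>" if "k < d" for k
    using le_lambda_max[OF W that, of q] lam unfolding qW by linarith
  have orthJK: "col U j \<bullet>c col W k = 0" if "j \<in> J" "k \<in> K" for j k
    using unitary_conj_col_mem_support[OF U, of j p] unitary_conj_col_mem_support[OF W, of k q] that orth
    unfolding orthogonal_supports_def pU qW J_def K_def by fastforce
  have np: "np \<ge> 1"
  proof -
    have "J \<noteq> {}" using sumJ by auto
    then show ?thesis using fin unfolding np_def by (simp add: Suc_leI card_gt_0_iff)
  qed
  \<comment> \<open>Unit trace is shared among \<open>nm\<close> eigenvalues of size at most
    \<open>\<Lambda>\<close>. This is the source of the -1 in the final logarithm.\<close>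
  have nm: "1 \<le> nm * \<Lambda>"
    using sum_bounded_above[of K q \<Lambda>] q_le sumK unfolding nm_def K_def by simp
  then have \<Lambda>: "\<Lambda> > 0" unfolding nm_def
    by (smt (verit) mult_nonneg_nonpos of_nat_0_le_iff)
  have dim: "np + nm \<le> real d"
  proof -
    have "quad_form (1\<^sub>m d) (col V j) = 1" if "unitary_mat d V" "j < d" for V j
      using col_unitary_cscalar_prod[OF that(1) that(2) that(2)]
        quad_form_one[OF col_unitary_carrier[OF that]] by simp
    then have "(\<Sum>j\<in>J. quad_form (1\<^sub>m d) (col U j)) = np" "(\<Sum>k\<in>K. quad_form (1\<^sub>m d) (col W k)) = nm"
      using U W JK unfolding np_def nm_def by (auto simp: subset_eq)
    moreover have "Re (mat_trace (1\<^sub>m d)) = real d" by (simp add: mat_trace_def)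
    ultimately show ?thesis
      using sum_quad_form_orthogonal_le_trace[OF psd_mat_one U W JK orthJK] by simp
  qed
  have eq': "\<rho>1 + complex_of_real \<epsilon> \<cdot>\<^sub>m \<rho>m = \<rho>2 + complex_of_real \<epsilon> \<cdot>\<^sub>m \<rho>p"
  proof (rule eq_matI)
    fix i j assume "i < dim_row (\<rho>2 + complex_of_real \<epsilon> \<cdot>\<^sub>m \<rho>p)" "j < dim_col (\<rho>2 + complex_of_real \<epsilon> \<cdot>\<^sub>m \<rho>p)"
    then have "i < d" "j < d" using carr by auto
    then show "(\<rho>1 + complex_of_real \<epsilon> \<cdot>\<^sub>m \<rho>m) $$ (i, j) = (\<rho>2 + complex_of_real \<epsilon> \<cdot>\<^sub>m \<rho>p) $$ (i, j)"
      using arg_cong[OF eq, of "\<lambda>M. M $$ (i, j)"] carr by (simp add: algebra_simps)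
  qed (use carr in auto)
  have proj: "(\<Sum>k\<in>K. quad_form \<rho>1 (col W k)) \<le> 1 - \<epsilon>"
  proof -
    have "quad_form \<rho>1 (col U j) \<ge> \<epsilon> * p j" if j: "j \<in> J" for j
    proof -
      have jd: "j < d" using j by (simp add: J_def)
      note u = col_unitary_carrier[OF U jd]
      have z: "q k * (cmod (col U j \<bullet>c col W k))\<^sup>2 = 0" if "k < d" for k
        using orthJK[OF j, of k] q(1)[OF that] that by (cases "q k = 0") (auto simp: K_def)
      have m: "quad_form \<rho>m (col U j) = 0"
        unfolding qW quad_form_unitary_conj[OF W u] by (rule sum.neutral) (use z in blast)
      have "quad_form \<rho>1 (col U j) + \<epsilon> * quad_form \<rho>m (col U j)
          = quad_form \<rho>2 (col U j) + \<epsilon> * quad_form \<rho>p (col U j)"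
        using arg_cong[OF eq', of "\<lambda>M. quad_form M (col U j)"]
        unfolding quad_form_add_smult[OF carr(1,4) u] quad_form_add_smult[OF carr(2,3) u] .
      then show ?thesis
        using m psd_mat_quad_form[OF psd(2) u] quad_form_unitary_conj_col[OF U jd, of p] unfolding pU by simp
    qed
    then have "(\<Sum>j\<in>J. \<epsilon> * p j) \<le> (\<Sum>j\<in>J. quad_form \<rho>1 (col U j))" by (rule sum_mono)
    then have "\<epsilon> \<le> (\<Sum>j\<in>J. quad_form \<rho>1 (col U j))" using sumJ by (simp flip: sum_distrib_left)
    then show ?thesis
      using sum_quad_form_orthogonal_le_trace[OF psd(1) U W JK orthJK] \<rho>1 by (simp add: density_mat_def)
  qed
  obtain E1 r1 where E1: "unitary_mat d E1" and r1E: "\<rho>1 = unitary_conj d E1 r1"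
    and r1: "\<And>k. k < d \<Longrightarrow> r1 k \<ge> 0" "sum r1 {..<d} = 1"
    using density_mat_spectral[OF \<rho>1] by blast
  obtain E2 r2 where E2: "unitary_mat d E2" and r2E: "\<rho>2 = unitary_conj d E2 r2"
    and r2: "\<And>k. k < d \<Longrightarrow> r2 k \<ge> 0" "sum r2 {..<d} = 1"
    using density_mat_spectral[OF \<rho>2] by blast
  \<comment> \<open>The regularised inequality. The factors \<open>1 * \<kappa>\<close> put every
    term in the shape of \<open>neg_xlogx_tendsto\<close>.\<close>
  have bound: "(\<Sum>j<d. neg_xlogx (r1 j + 1 * \<kappa>)) - (\<Sum>j<d. neg_xlogx (r2 j + 1 * \<kappa>))
      \<le> \<epsilon> * ln np + \<epsilon> * ln \<Lambda> + neg_xlogx (\<epsilon> + 1 * \<kappa>) - neg_xlogx (0 + 1 * \<kappa>)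
        + neg_xlogx (1 - \<epsilon> + real d * \<kappa>) - neg_xlogx (1 + real d * \<kappa>)" if \<kappa>: "\<kappa> > 0" for \<kappa>
  proof -
    define X where "X u = regularize d \<kappa> \<rho>1 + complex_of_real u \<cdot>\<^sub>m \<rho>m" for u
    define Y where "Y u = regularize d \<kappa> \<rho>2 + complex_of_real u \<cdot>\<^sub>m \<rho>p" for u
    let ?F = "trace_fun d neg_xlogx"
    \<comment> \<open>First leg, from \<open>\<rho>2\<close> to the common endpoint.
      \<open>G\<close> is an antiderivative of the decreasing rate \<open>g\<close>.\<close>
    have "?F (Y \<epsilon>) - ?F (Y 0)
      \<le> (\<epsilon> * ln np + neg_xlogx (\<epsilon> + \<kappa>)) - (0 * ln np + neg_xlogx (0 + \<kappa>))"
    proof (rule increment_bound_decr[where g = "\<lambda>u. ln (np / (u + \<kappa>)) - 1" and \<phi> = "\<lambda>u. ?F (Y u)"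
          and G = "\<lambda>u. u * ln np + neg_xlogx (u + \<kappa>)", OF \<epsilon>(1)])
      fix u w :: real assume uw: "0 \<le> u" "u < w" "w \<le> \<epsilon>"
      show "?F (Y w) - ?F (Y u) \<le> (w - u) * (ln (np / (u + \<kappa>)) - 1)"
        using trace_neg_xlogx_path_upper[OF psd(2) \<rho>p[unfolded pU] \<kappa> uw(1,2) U p]
        unfolding Y_def pU np_def J_def .
      show "(w - u) * (ln (np / (w + \<kappa>)) - 1)
          \<le> w * ln np + neg_xlogx (w + \<kappa>) - (u * ln np + neg_xlogx (u + \<kappa>))"
        using neg_xlogx_tangent[of "u + \<kappa>" "w + \<kappa>"] uw \<kappa> np by (simp add: ln_div algebra_simps)
    qed
    \<comment> \<open>Second leg, back to \<open>\<rho>1\<close>; the sign is reversed so that the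
      parameter still increases. The rate is now increasing, and \<open>G\<close> is again its
      antiderivative.\<close>
    moreover have "- ?F (X \<epsilon>) - (- ?F (X 0))
      \<le> (\<epsilon> * ln \<Lambda> - neg_xlogx (1 - \<epsilon> + real d * \<kappa> + \<epsilon>)) - (0 * ln \<Lambda> - neg_xlogx (1 - \<epsilon> + real d * \<kappa> + 0))"
    proof (rule increment_bound_incr[where g = "\<lambda>u. ln (\<Lambda> * (1 - \<epsilon> + real d * \<kappa> + u)) + 1"
          and \<phi> = "\<lambda>u. - ?F (X u)"
          and G = "\<lambda>u. u * ln \<Lambda> - neg_xlogx (1 - \<epsilon> + real d * \<kappa> + u)", OF \<epsilon>(1)])
      fix u w :: real assume uw: "0 \<le> u" "u < w" "w \<le> \<epsilon>"
      \<comment> \<open>Positivity of \<open>d\<close> keeps the logarithm's argument positive even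
        for \<open>\<epsilon> = 1\<close> and \<open>u = 0\<close>.\<close>
      have d0: "real d > 0" using np dim nm_def by linarith
      have pos: "1 - \<epsilon> + real d * \<kappa> + u > 0" "1 - \<epsilon> + real d * \<kappa> + w > 0"
        using \<epsilon> uw \<kappa> d0 by (simp_all add: add_nonneg_pos add_pos_nonneg)
      have w: "0 \<le> w" using uw by simp
      have "(\<Sum>k<d. q k * quad_form (X w) (col W k)) = (\<Sum>k\<in>K. q k * quad_form (X w) (col W k))"
        using JK q(1) by (intro sum.mono_neutral_right) (force simp: K_def not_less)+
      also have "\<dots> \<le> (\<Sum>k\<in>K. \<Lambda> * (quad_form \<rho>1 (col W k) + \<kappa> + w * q k))"
      proof (rule sum_mono)
        fix k assume "k \<in> K"
        then have k: "k < d" by (simp add: K_def)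
        have "quad_form (X w) (col W k) = quad_form \<rho>1 (col W k) + \<kappa> + w * q k"
          using regularized_path(2)[OF psd(1,4) \<kappa> w col_unitary_carrier[OF W k]]
            col_unitary_cscalar_prod[OF W k k] quad_form_unitary_conj_col[OF W k, of q]
          unfolding X_def qW by simp
        moreover have "quad_form (X w) (col W k) \<ge> 0"
          unfolding X_def by (intro psd_mat_quad_form[OF regularized_path(1)[OF psd(1,4) \<kappa> w]]
             col_unitary_carrier[OF W k])
        ultimately show "q k * quad_form (X w) (col W k) \<le> \<Lambda> * (quad_form \<rho>1 (col W k) + \<kappa> + w * q k)"
          using q_le[OF k] by (metis mult_right_mono)
      qed
      also have "\<dots> = \<Lambda> * ((\<Sum>k\<in>K. quad_form \<rho>1 (col W k)) + nm * \<kappa> + w * sum q K)"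
        by (simp add: sum.distrib nm_def flip: sum_distrib_left)
      also have "\<dots> \<le> \<Lambda> * (1 - \<epsilon> + real d * \<kappa> + w)"
      \<comment> \<open>The shift adds \<open>\<kappa>\<close> for each of the \<open>nm\<close>
        eigenvectors; replacing \<open>nm\<close> by \<open>d\<close> yields the term
        \<open>real d * \<kappa>\<close>.\<close>
      proof (rule mult_left_mono)
        have "nm * \<kappa> \<le> real d * \<kappa>" using dim np \<kappa> by (intro mult_right_mono) auto
        then show "(\<Sum>k\<in>K. quad_form \<rho>1 (col W k)) + nm * \<kappa> + w * sum q K \<le> 1 - \<epsilon> + real d * \<kappa> + w"
          using proj sumK by simp
      qed (use \<Lambda> in simp)
      finally have T: "(\<Sum>k<d. q k * quad_form (X w) (col W k)) \<le> \<Lambda> * (1 - \<epsilon> + real d * \<kappa> + w)" .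
      show "- ?F (X w) - (- ?F (X u)) \<le> (w - u) * (ln (\<Lambda> * (1 - \<epsilon> + real d * \<kappa> + w)) + 1)"
        using trace_neg_xlogx_path_lower[OF psd(1) \<rho>m[unfolded qW] \<kappa> uw(1,2) W
            T[unfolded X_def qW]] \<Lambda> pos unfolding X_def qW by simp
      have lnm: "ln (\<Lambda> * (1 - \<epsilon> + real d * \<kappa> + u)) = ln \<Lambda> + ln (1 - \<epsilon> + real d * \<kappa> + u)"
        using pos \<Lambda> by (intro ln_mult_pos)
      show "(w - u) * (ln (\<Lambda> * (1 - \<epsilon> + real d * \<kappa> + u)) + 1)
        \<le> w * ln \<Lambda> - neg_xlogx (1 - \<epsilon> + real d * \<kappa> + w) - (u * ln \<Lambda> - neg_xlogx (1 - \<epsilon> + real d * \<kappa> + u))"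
        unfolding lnm using neg_xlogx_tangent[of "1 - \<epsilon> + real d * \<kappa> + w" "1 - \<epsilon> + real d * \<kappa> + u"] pos
        by (simp add: algebra_simps)
    qed
    \<comment> \<open>Both legs end at the same matrix, so its trace function cancels when they are
      added.\<close>
    moreover have "X \<epsilon> = Y \<epsilon>"
    proof (rule eq_matI)
      fix i j assume "i < dim_row (Y \<epsilon>)" "j < dim_col (Y \<epsilon>)"
      then have "i < d" "j < d" using carr by (auto simp: Y_def)
      then show "X \<epsilon> $$ (i, j) = Y \<epsilon> $$ (i, j)"
        using arg_cong[OF eq', of "\<lambda>M. M $$ (i, j)"] carr
        by (simp add: X_def Y_def regularize_def algebra_simps)
    qed (use carr in \<open>auto simp: X_def Y_def regularize_def\<close>)
    moreover have "X 0 = regularize d \<kappa> \<rho>1" "Y 0 = regularize d \<kappa> \<rho>2"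
      using carr by (auto simp: X_def Y_def regularize_def intro!: eq_matI)
    then have "?F (X 0) = (\<Sum>j<d. neg_xlogx (r1 j + 1 * \<kappa>))" "?F (Y 0) = (\<Sum>j<d. neg_xlogx (r2 j + 1 * \<kappa>))"
      unfolding r1E r2E regularize_unitary_conj[OF E1] regularize_unitary_conj[OF E2]
      by (simp_all add: trace_fun_unitary_conj[OF E1] trace_fun_unitary_conj[OF E2])
    ultimately show ?thesis by simp
  qed
  have "(\<Sum>j<d. neg_xlogx (r1 j)) - (\<Sum>j<d. neg_xlogx (r2 j))
      \<le> \<epsilon> * ln np + \<epsilon> * ln \<Lambda> + neg_xlogx \<epsilon> - neg_xlogx 0 + neg_xlogx (1 - \<epsilon>) - neg_xlogx 1"
  \<comment> \<open>Let \<open>\<kappa>\<close> tend to 0 from the right on both sides of the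
    regularised inequality.\<close>
  proof (rule tendsto_le[of "at_right 0"])
    show "((\<lambda>\<kappa>. (\<Sum>j<d. neg_xlogx (r1 j + 1 * \<kappa>)) - (\<Sum>j<d. neg_xlogx (r2 j + 1 * \<kappa>))) \<longlongrightarrow>
        (\<Sum>j<d. neg_xlogx (r1 j)) - (\<Sum>j<d. neg_xlogx (r2 j))) (at_right 0)"
      using r1 r2 by (intro tendsto_diff tendsto_sum neg_xlogx_tendsto) auto
    show "((\<lambda>\<kappa>. \<epsilon> * ln np + \<epsilon> * ln \<Lambda> + neg_xlogx (\<epsilon> + 1 * \<kappa>) - neg_xlogx (0 + 1 * \<kappa>)
        + neg_xlogx (1 - \<epsilon> + real d * \<kappa>) - neg_xlogx (1 + real d * \<kappa>)) \<longlongrightarrow>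
      \<epsilon> * ln np + \<epsilon> * ln \<Lambda> + neg_xlogx \<epsilon> - neg_xlogx 0 + neg_xlogx (1 - \<epsilon>) - neg_xlogx 1) (at_right 0)"
      using \<epsilon> by (intro tendsto_diff tendsto_add tendsto_const neg_xlogx_tendsto) auto
    show "\<forall>\<^sub>F \<kappa> in at_right 0. (\<Sum>j<d. neg_xlogx (r1 j + 1 * \<kappa>)) - (\<Sum>j<d. neg_xlogx (r2 j + 1 * \<kappa>))
      \<le> \<epsilon> * ln np + \<epsilon> * ln \<Lambda> + neg_xlogx (\<epsilon> + 1 * \<kappa>) - neg_xlogx (0 + 1 * \<kappa>)
        + neg_xlogx (1 - \<epsilon> + real d * \<kappa>) - neg_xlogx (1 + real d * \<kappa>)"
      using eventually_at_right_less[of "0 :: real"] by (rule eventually_mono) (rule bound)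
  qed simp
  also have "\<dots> = \<epsilon> * ln (np * \<Lambda>) + binary_entropy \<epsilon>"
    using np \<Lambda> by (simp add: ln_mult neg_xlogx_def binary_entropy_def algebra_simps)
  \<comment> \<open>Orthogonality gives \<open>np \<le> d - nm\<close>, and
    \<open>nm * \<Lambda> \<ge> 1\<close> turns the subtracted term into 1.\<close>
  also have "ln (np * \<Lambda>) \<le> ln (real d * \<Lambda> - 1)"
  proof -
    have "np * \<Lambda> \<le> (real d - nm) * \<Lambda>" using dim \<Lambda> by (intro mult_right_mono) auto
    then have "np * \<Lambda> \<le> real d * \<Lambda> - 1" using nm by (simp add: left_diff_distrib)
    moreover have "np * \<Lambda> > 0" using np \<Lambda> by simp
    ultimately show ?thesis by simp
  qed
  finally have "(\<Sum>j<d. neg_xlogx (r1 j)) - (\<Sum>j<d. neg_xlogx (r2 j))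
      \<le> \<epsilon> * ln (real d * \<Lambda> - 1) + binary_entropy \<epsilon>"
    using \<epsilon>(1) by (simp add: mult_left_mono)
  then show ?thesis
    unfolding r1E r2E von_neumann_entropy_unitary_conj[OF E1] von_neumann_entropy_unitary_conj[OF E2]
    by (simp add: neg_xlogx_def)
qed

theorem theorem4:
  fixes d :: nat and \<epsilon> :: real and \<rho>\<^sub>1 \<rho>\<^sub>2 \<rho>p \<rho>m :: "complex mat"
  assumes "density_mat d \<rho>\<^sub>1" and "density_mat d \<rho>\<^sub>2"
    and "0 \<le> \<epsilon>" and "\<epsilon> \<le> 1"
    and "1 / 2 * trace_norm d (\<rho>\<^sub>1 - \<rho>\<^sub>2) = \<epsilon>"
    and "density_mat d \<rho>p" and "density_mat d \<rho>m"
    and "orthogonal_supports d \<rho>p \<rho>m"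
    and "\<rho>\<^sub>1 - \<rho>\<^sub>2 = complex_of_real \<epsilon> \<cdot>\<^sub>m \<rho>p - complex_of_real \<epsilon> \<cdot>\<^sub>m \<rho>m"
  shows "\<bar>von_neumann_entropy d \<rho>\<^sub>1 - von_neumann_entropy d \<rho>\<^sub>2\<bar>
    \<le> \<epsilon> * ln (real d * max (lambda_max \<rho>m) (lambda_max \<rho>p) - 1) + binary_entropy \<epsilon>"
proof -
  have carr: "\<rho>\<^sub>1 \<in> carrier_mat d d" "\<rho>\<^sub>2 \<in> carrier_mat d d" "\<rho>p \<in> carrier_mat d d" "\<rho>m \<in> carrier_mat d d"
    using assms(1,2,6,7) by (auto simp: density_mat_def intro: psd_mat_carrier)
  \<comment> \<open>The absolute value combines two one-sided bounds. Exchanging the states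
    exchanges \<open>\<rho>p\<close> and \<open>\<rho>m\<close>, so orthogonality and the
    decomposition are first restated in swapped form.\<close>
  have "orthogonal_supports d \<rho>m \<rho>p"
    unfolding orthogonal_supports_def
  proof (intro ballI)
    fix v w assume vw: "v \<in> mat_support d \<rho>m" "w \<in> mat_support d \<rho>p"
    then have "v \<in> carrier_vec d" "w \<in> carrier_vec d" by (auto simp: mat_support_def)
    moreover have "w \<bullet>c v = 0" using vw assms(8) unfolding orthogonal_supports_def by blast
    ultimately show "v \<bullet>c w = 0" using cscalar_prod_commute[of v d w] by simp
  qed
  moreover have "\<rho>\<^sub>2 - \<rho>\<^sub>1 = complex_of_real \<epsilon> \<cdot>\<^sub>m \<rho>m - complex_of_real \<epsilon> \<cdot>\<^sub>m \<rho>p"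
  proof (rule eq_matI)
    fix i j assume "i < dim_row (complex_of_real \<epsilon> \<cdot>\<^sub>m \<rho>m - complex_of_real \<epsilon> \<cdot>\<^sub>m \<rho>p)"
      "j < dim_col (complex_of_real \<epsilon> \<cdot>\<^sub>m \<rho>m - complex_of_real \<epsilon> \<cdot>\<^sub>m \<rho>p)"
    then have "i < d" "j < d" using carr by auto
    then show "(\<rho>\<^sub>2 - \<rho>\<^sub>1) $$ (i, j) = (complex_of_real \<epsilon> \<cdot>\<^sub>m \<rho>m - complex_of_real \<epsilon> \<cdot>\<^sub>m \<rho>p) $$ (i, j)"
      using arg_cong[OF assms(9), of "\<lambda>M. M $$ (i, j)"] carr by (simp add: algebra_simps)
  qed (use carr in auto)
  ultimately show ?thesis
    using entropy_difference_le[OF assms(1-4,6-9), of "max (lambda_max \<rho>m) (lambda_max \<rho>p)"]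
      entropy_difference_le[OF assms(2,1,3,4,7,6), of "max (lambda_max \<rho>m) (lambda_max \<rho>p)"]
    by (simp add: abs_le_iff)
qed

end
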